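(* Let $\mathcal{H}$ be a complex Hilbert space, let $A_1,A_2,B_1,B_2,X_1,X_2\in\mathcal{B}(\mathcal{H})$, and let $\mathbb{A}=\begin{bmatrix}0&A_1\\ A_2&0\end{bmatrix}$, $\mathbb{B}=\begin{bmatrix}0&B_1\\ B_2&0\end{bmatrix}$ and $\mathbb{Y}=\begin{bmatrix}0&X_1\\ X_2&0\end{bmatrix}$ in $\mathcal{B}(\mathcal{H}\oplus\mathcal{H})$. Then $$\omega^{r}\left(|\mathbb{A}|^{\alpha}\mathbb{Y}|\mathbb{B}|^{1-\alpha}\right)\le\max\left\{\|X_1\|^r,\|X_2\|^r\right\}\max\left\{\left\|\alpha|A_2|^{r}+(1-\alpha)|B_2|^{r}\right\|,\left\|\alpha|A_1|^{r}+(1-\alpha)|B_1|^{r}\right\|\right\}$$ for all $r\ge2$ and $\alpha\in[0,1]$.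
   Context: $\mathcal{B}(\cdot)$ denotes the algebra of bounded linear operators on a Hilbert space and $\|\cdot\|$ the operator norm. The numerical radius of a bounded operator $A$ on a complex Hilbert space is $\omega(A)=\sup_{\|x\|=1}|\langle Ax,x\rangle|$, and $\omega^s(A)=(\omega(A))^s$. $|A|=(A^*A)^{1/2}$; powers of positive operators are defined by the continuous functional calculus. *)

theory Defs
  imports "HOL-Analysis.Analysis" "HOL-Computational_Algebra.Polynomial"
begin

section \<open>Complex Hilbert spaces\<close>

text \<open>The inner product is linear in the first argument.  The underlying real normed space
  structure is the one induced by the complex structure.\<close>

class complex_inner = real_normed_vector +
  fixes scaleC :: "complex \<Rightarrow> 'a \<Rightarrow> 'a"  (infixr \<open>*\<^sub>C\<close> 75)
    and cinner :: "'a \<Rightarrow> 'a \<Rightarrow> complex"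
  assumes scaleC_add_right: "c *\<^sub>C (x + y) = c *\<^sub>C x + c *\<^sub>C y"
    and scaleC_add_left: "(c + d) *\<^sub>C x = c *\<^sub>C x + d *\<^sub>C x"
    and scaleC_scaleC: "c *\<^sub>C d *\<^sub>C x = (c * d) *\<^sub>C x"
    and scaleR_scaleC: "r *\<^sub>R x = complex_of_real r *\<^sub>C x"
    and cinner_commute: "cinner x y = cnj (cinner y x)"
    and cinner_add_left: "cinner (x + y) z = cinner x z + cinner y z"
    and cinner_scaleC_left: "cinner (c *\<^sub>C x) y = c * cinner x y"
    and cinner_ge_zero: "0 \<le> Re (cinner x x)"
    and cinner_eq_zero_iff: "cinner x x = 0 \<longleftrightarrow> x = 0"
    and norm_eq_sqrt_cinner: "norm x = sqrt (Re (cinner x x))"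

class chilbert_space = complex_inner + complete_space

text \<open>The orthogonal direct sum of two Hilbert spaces is their product type; the library norm
  on products is already the Euclidean one.\<close>

instantiation prod :: (complex_inner, complex_inner) complex_inner
begin

definition scaleC_prod :: "complex \<Rightarrow> 'a \<times> 'b \<Rightarrow> 'a \<times> 'b"
  where "scaleC_prod c v = (c *\<^sub>C fst v, c *\<^sub>C snd v)"

definition cinner_prod :: "'a \<times> 'b \<Rightarrow> 'a \<times> 'b \<Rightarrow> complex"
  where "cinner_prod v w = cinner (fst v) (fst w) + cinner (snd v) (snd w)"

instance
proof
  fix c d :: complex and r :: real and x y z :: "'a \<times> 'b"
  show "c *\<^sub>C (x + y) = c *\<^sub>C x + c *\<^sub>C y"
    by (simp add: scaleC_prod_def scaleC_add_right)
  show "(c + d) *\<^sub>C x = c *\<^sub>C x + d *\<^sub>C x"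
    by (simp add: scaleC_prod_def scaleC_add_left)
  show "c *\<^sub>C d *\<^sub>C x = (c * d) *\<^sub>C x"
    by (simp add: scaleC_prod_def scaleC_scaleC)
  show "r *\<^sub>R x = complex_of_real r *\<^sub>C x"
    by (simp add: scaleC_prod_def scaleR_prod_def scaleR_scaleC)
  show "cinner x y = cnj (cinner y x)"
    by (simp add: cinner_prod_def cinner_commute[of "fst x"] cinner_commute[of "snd x"])
  show "cinner (x + y) z = cinner x z + cinner y z"
    by (simp add: cinner_prod_def cinner_add_left)
  show "cinner (c *\<^sub>C x) y = c * cinner x y"
    by (simp add: cinner_prod_def scaleC_prod_def cinner_scaleC_left distrib_left)
  show "0 \<le> Re (cinner x x)"
    by (simp add: cinner_prod_def cinner_ge_zero)
  show "norm x = sqrt (Re (cinner x x))"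
    by (simp add: cinner_prod_def norm_prod_def norm_eq_sqrt_cinner cinner_ge_zero)
  show "cinner x x = 0 \<longleftrightarrow> x = 0"
  proof
    assume "cinner x x = 0"
    then have "Re (cinner (fst x) (fst x)) + Re (cinner (snd x) (snd x)) = 0"
      by (metis cinner_prod_def plus_complex.sel(1) zero_complex.sel(1))
    then have "Re (cinner (fst x) (fst x)) = 0" "Re (cinner (snd x) (snd x)) = 0"
      using cinner_ge_zero[of "fst x"] cinner_ge_zero[of "snd x"] by linarith+
    then have "norm (fst x) = 0" "norm (snd x) = 0"
      by (simp_all only: norm_eq_sqrt_cinner real_sqrt_zero)
    then show "x = 0"
      by (simp add: prod_eq_iff)
  next
    assume "x = 0"
    then show "cinner x x = 0"
      by (simp add: cinner_prod_def cinner_eq_zero_iff[THEN iffD2])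
  qed
qed

end

instance prod :: (chilbert_space, chilbert_space) chilbert_space ..


section \<open>Bounded operators\<close>

text \<open>Operators are functions satisfying \<open>bounded_clinear\<close>; their operator norm is the library's
  \<^const>\<open>onorm\<close>.\<close>

definition bounded_clinear :: "('a::complex_inner \<Rightarrow> 'b::complex_inner) \<Rightarrow> bool"
  where "bounded_clinear A \<longleftrightarrow> bounded_linear A \<and> (\<forall>c x. A (c *\<^sub>C x) = c *\<^sub>C A x)"

definition cadjoint :: "('a::complex_inner \<Rightarrow> 'b::complex_inner) \<Rightarrow> 'b \<Rightarrow> 'a"
  where "cadjoint A = (THE B. \<forall>x y. cinner (A x) y = cinner x (B y))"

definition block_op ::
  "('a::complex_inner \<Rightarrow> 'c::complex_inner) \<Rightarrow> ('b::complex_inner \<Rightarrow> 'c) \<Rightarrow>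
   ('a \<Rightarrow> 'd::complex_inner) \<Rightarrow> ('b \<Rightarrow> 'd) \<Rightarrow> 'a \<times> 'b \<Rightarrow> 'c \<times> 'd"
  where "block_op A B C D = (\<lambda>(x, y). (A x + B y, C x + D y))"

text \<open>Inserting \<open>0\<close> only matters on the zero space, where there are no unit vectors.\<close>

definition numerical_radius :: "('a::complex_inner \<Rightarrow> 'a) \<Rightarrow> real"
  where "numerical_radius A = Sup (insert 0 {cmod (cinner (A x) x) | x. norm x = 1})"


section \<open>Continuous functional calculus\<close>

definition spectrum :: "('a::complex_inner \<Rightarrow> 'a) \<Rightarrow> complex set"
  where "spectrum A = {z. \<not> (\<exists>B. bounded_clinear B \<and>
           (\<forall>x. B (A x - z *\<^sub>C x) = x) \<and> (\<forall>x. A (B x) - z *\<^sub>C B x = x))}"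

definition poly_op :: "complex poly \<Rightarrow> ('a::complex_inner \<Rightarrow> 'a) \<Rightarrow> 'a \<Rightarrow> 'a"
  where "poly_op p A = (\<lambda>x. \<Sum>i\<le>degree p. coeff p i *\<^sub>C (A ^^ i) x)"

text \<open>For self-adjoint \<open>A\<close> the spectrum is a compact subset of the real line, so that polynomials
  are uniformly dense in the continuous functions on it, and \<open>f(A)\<close> is the norm limit of \<open>p\<^sub>n(A)\<close>
  for any polynomials \<open>p\<^sub>n\<close> converging to \<open>f\<close> uniformly on the spectrum.  For an \<open>A\<close> that is
  not self-adjoint, or an \<open>f\<close> that is not continuous on the spectrum, no meaning is intended.\<close>

definition cfc :: "(complex \<Rightarrow> complex) \<Rightarrow> ('a::complex_inner \<Rightarrow> 'a) \<Rightarrow> 'a \<Rightarrow> 'a"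
  where "cfc f A = (THE T. bounded_clinear T \<and>
           (\<forall>p. uniform_limit (spectrum A) (\<lambda>n. poly (p n)) f sequentially \<longrightarrow>
                (\<lambda>n. onorm (\<lambda>x. poly_op (p n) A x - T x)) \<longlonglongrightarrow> 0))"

text \<open>Powers of a positive operator with exponent \<open>s \<ge> 0\<close>.  The case distinction makes
  \<open>t \<mapsto> t\<^sup>0\<close> the constant function \<open>1\<close> (the library has \<open>0 powr 0 = 0\<close>), so the zeroth power is
  the identity operator.\<close>

definition op_powr :: "('a::complex_inner \<Rightarrow> 'a) \<Rightarrow> real \<Rightarrow> 'a \<Rightarrow> 'a"
  where "op_powr P s = cfc (\<lambda>t. complex_of_real (if s = 0 then 1 else Re t powr s)) P"

definition op_abs :: "('a::complex_inner \<Rightarrow> 'a) \<Rightarrow> 'a \<Rightarrow> 'a"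
  where "op_abs A = op_powr (cadjoint A \<circ> A) (1 / 2)"

end

(*
  Write P = |AA| and Q = |BB|.  For a unit vector v the Cauchy-Schwarz inequality bounds
  |<P^a Y Q^(1-a) v, v>| by ||Y|| ||P^a v|| ||Q^(1-a) v||, and ||P^a v||^2 = <P^(2a) v, v>.  Since
  2a <= r, McCarthy's inequality gives ||P^a v||^r <= <P^r v, v>^a, likewise for Q, and Young's
  inequality turns the product into a <P^r v, v> + (1-a) <Q^r v, v>.  Off-diagonal block operators
  have diagonal absolute values, so this quadratic form splits into the two summands of the bound.

  The calculus behind the powers rests on ||p(P)|| <= sup |p| over the spectrum: ||p(P)||^2 is an
  approximate eigenvalue of p(P)* p(P), and factoring the polynomial (cnj p) p - ||p(P)||^2 into
  linear factors turns this into a spectral value of P where |p| = ||p(P)||.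
*)

theory Submission
  imports Defs "HOL-Computational_Algebra.Fundamental_Theorem_Algebra"
begin

subsection \<open>Inner products\<close>

text \<open>\<open>cfc\<close> is a definite description: it names an operator only when a single
  bounded operator is the norm limit along every polynomial sequence that approximates the function
  on the spectrum. Each use owes existence of the limit and independence of the sequence, and both
  come from the norm bound for polynomials. No spectral measure enters. McCarthy's inequality is a
  scalar tangent-line inequality carried over to quadratic forms by positivity of the calculus. Its
  bound is stated with a free M > 0 above the form of P^r, because the tangent at M involves M to
  the power s/r - 1 and the form itself may vanish. Approximation uses real polynomials on an
  interval [0,R] that contains the spectrum. Real coefficients keep the approximants symmetric, and
  a common R lets a direct sum and its summands share one sequence, so powers of a diagonal operator
  are diagonal without any comparison of spectra.\<close>

instance chilbert_space \<subseteq> banach ..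

lemma cinner_add_right: "cinner x (y + z) = cinner x y + cinner x z"
  by (metis cinner_add_left cinner_commute complex_cnj_add)

lemma cinner_scaleC_right: "cinner x (c *\<^sub>C y) = cnj c * cinner x y"
  by (metis cinner_scaleC_left cinner_commute complex_cnj_mult)

lemma cinner_scaleR_left: "cinner (r *\<^sub>R x) y = of_real r * cinner x y"
  by (simp add: scaleR_scaleC cinner_scaleC_left)

lemma cinner_scaleR_right: "cinner x (r *\<^sub>R y) = of_real r * cinner x y"
  by (simp add: scaleR_scaleC cinner_scaleC_right)

lemma cinner_zero_left [simp]: "cinner 0 y = 0"
  using cinner_add_left[of 0 0 y] by simp

lemma cinner_zero_right [simp]: "cinner x 0 = 0"
  using cinner_add_right[of x 0 0] by simp

lemma cinner_minus_left: "cinner (- x) y = - cinner x y"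
  using cinner_add_left[of x "- x" y] by (simp add: add_eq_0_iff)

lemma cinner_minus_right: "cinner x (- y) = - cinner x y"
  using cinner_add_right[of x y "- y"] by (simp add: add_eq_0_iff)

lemma cinner_diff_left: "cinner (x - y) z = cinner x z - cinner y z"
  using cinner_add_left[of x "- y" z] by (simp add: cinner_minus_left)

lemma cinner_diff_right: "cinner x (y - z) = cinner x y - cinner x z"
  using cinner_add_right[of x y "- z"] by (simp add: cinner_minus_right)

lemma Re_cinner_commute: "Re (cinner x y) = Re (cinner y x)"
  by (metis cinner_commute complex_cnj(1) complex.exhaust_sel complex.sel(1))

lemma Re_cinner_self: "Re (cinner x x) = (norm x)\<^sup>2"
  by (simp add: norm_eq_sqrt_cinner cinner_ge_zero)

lemma cinner_self: "cinner x x = complex_of_real ((norm x)\<^sup>2)"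
proof -
  have "Im (cinner x x) = 0"
    by (metis cinner_commute cnj.sel(2) equal_neg_zero)
  then show ?thesis
    by (simp add: complex_eq_iff Re_cinner_self)
qed

lemma norm_scaleC [simp]: "norm (c *\<^sub>C x) = cmod c * norm x"
proof -
  have "cinner (c *\<^sub>C x) (c *\<^sub>C x) = (c * cnj c) * cinner x x"
    by (simp add: cinner_scaleC_left cinner_scaleC_right)
  also have "\<dots> = complex_of_real ((cmod c * norm x)\<^sup>2)"
    by (simp only: complex_norm_square[symmetric] cinner_self of_real_mult of_real_power
        power_mult_distrib)
  finally have "(norm (c *\<^sub>C x))\<^sup>2 = (cmod c * norm x)\<^sup>2"
    by (simp only: cinner_self of_real_eq_iff)
  then show ?thesis
    by (simp add: power2_eq_iff_nonneg)
qed

lemma scaleC_zero_right [simp]: "c *\<^sub>C 0 = (0::'a::complex_inner)"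
  using scaleC_add_right[of c 0 0] by simp

lemma scaleC_zero_left [simp]: "0 *\<^sub>C (x::'a::complex_inner) = 0"
  using scaleC_add_left[of 0 0 x] by simp

lemma scaleC_minus_left: "(- c) *\<^sub>C (x::'a::complex_inner) = - (c *\<^sub>C x)"
  using scaleC_add_left[of c "- c" x] by (simp add: add_eq_0_iff)

lemma scaleC_minus_right: "c *\<^sub>C (- x) = - (c *\<^sub>C (x::'a::complex_inner))"
  using scaleC_add_right[of c x "- x"] by (simp add: add_eq_0_iff)

lemma scaleC_diff_right: "c *\<^sub>C (x - y) = c *\<^sub>C x - c *\<^sub>C (y::'a::complex_inner)"
  using scaleC_add_right[of c x "- y"] by (simp add: scaleC_minus_right)

lemma scaleC_one [simp]: "1 *\<^sub>C (x::'a::complex_inner) = x"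
  by (metis of_real_1 scaleR_scaleC scaleR_one)

lemma norm_add_square: "(norm (x + y))\<^sup>2 = (norm x)\<^sup>2 + 2 * Re (cinner x y) + (norm y)\<^sup>2"
  using Re_cinner_commute[of x y]
  by (simp add: Re_cinner_self[symmetric] cinner_add_left cinner_add_right)

lemma norm_diff_square: "(norm (x - y))\<^sup>2 = (norm x)\<^sup>2 - 2 * Re (cinner x y) + (norm y)\<^sup>2"
  using norm_add_square[of x "- y"] by (simp add: cinner_minus_right)

text \<open>The class supplies the triangle inequality, so the usual order is reversed: comparing
  the two squared sides of it leaves Cauchy-Schwarz.\<close>

lemma Re_cinner_le: "Re (cinner x y) \<le> norm x * norm y"
proof -
  have "(norm (x + y))\<^sup>2 \<le> (norm x + norm y)\<^sup>2"
    by (intro power_mono norm_triangle_ineq) simp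
  then show ?thesis
    by (simp add: norm_add_square power2_sum)
qed

lemma cmod_cinner_le: "cmod (cinner x y) \<le> norm x * norm y"
proof -
  \<comment> \<open>Rotating x by this phase makes the product real and equal to its modulus. For a
    zero product \<open>sgn\<close> is 0 and so is \<open>?c\<close>, hence only
    \<open>\<le>\<close> in the last estimate.\<close>
  let ?c = "cnj (sgn (cinner x y))"
  have "cinner (?c *\<^sub>C x) y = complex_of_real (cmod (cinner x y))"
    by (cases "cinner x y = 0")
      (simp_all add: cinner_scaleC_left sgn_eq mult.commute complex_norm_square[symmetric]
        power2_eq_square)
  then have "cmod (cinner x y) \<le> norm (?c *\<^sub>C x) * norm y"
    using Re_cinner_le[of "?c *\<^sub>C x" y] by simp
  also have "\<dots> \<le> norm x * norm y"
    by (intro mult_right_mono) (auto simp: norm_sgn)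
  finally show ?thesis .
qed

lemma cinner_ext:
  assumes "\<And>x. cinner x y = cinner x z"
  shows "y = z"
proof -
  have "cinner (y - z) (y - z) = 0"
    using assms by (simp add: cinner_diff_right)
  then show ?thesis
    by (simp add: cinner_eq_zero_iff)
qed

lemma Re_cinner_ext:
  assumes "\<And>x. Re (cinner x y) = Re (cinner x z)"
  shows "y = z"
proof -
  have "Re (cinner (y - z) (y - z)) = 0"
    using assms by (simp add: cinner_diff_right)
  then show ?thesis
    by (simp add: Re_cinner_self)
qed

text \<open>Conjugate-linear in the second argument, but bilinear over the reals, which is what the
  limit rules ask for.\<close>

lemma bounded_bilinear_cinner: "bounded_bilinear cinner"
proof
  show "\<exists>K. \<forall>a b. norm (cinner a b) \<le> norm a * norm b * K"
    by (rule exI[of _ 1]) (simp add: cmod_cinner_le)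
qed (simp_all add: cinner_add_left cinner_add_right cinner_scaleR_left cinner_scaleR_right
    scaleR_conv_of_real)

lemma bounded_bilinear_Re_cinner: "bounded_bilinear (\<lambda>x y. Re (cinner x y))"
proof
  show "\<exists>K. \<forall>a b. norm (Re (cinner a b)) \<le> norm a * norm b * K"
    by (rule exI[of _ 1]) (auto intro: order_trans[OF abs_Re_le_cmod cmod_cinner_le])
qed (simp_all add: cinner_add_left cinner_add_right cinner_scaleR_left cinner_scaleR_right)

lemmas tendsto_Re_cinner = bounded_bilinear.tendsto[OF bounded_bilinear_Re_cinner]


subsection \<open>Representation of functionals\<close>

text \<open>Both the adjoint and the inverse of an operator bounded below come from this variational
  form of the Riesz theorem: \<open>u\<close> minimises \<open>b x x - 2 f x\<close>.\<close>

lemma coercive_form_represents: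
  fixes b :: "'a::{real_normed_vector, complete_space} \<Rightarrow> 'a \<Rightarrow> real"
  assumes b: "bounded_bilinear b" and sym: "\<And>x y. b x y = b y x"
    and c: "c > 0" and coercive: "\<And>x. c * (norm x)\<^sup>2 \<le> b x x"
    and f: "bounded_linear f"
  obtains u where "\<And>y. b u y = f y"
proof -
  interpret b: bounded_bilinear b by (fact b)
  interpret f: bounded_linear f by (fact f)
  define J where "J x = b x x - 2 * f x" for x
  have J_lower: "- ((onorm f)\<^sup>2 / c) \<le> J x" for x
  proof -
    have "f x \<le> onorm f * norm x"
      using onorm[OF f, of x] by simp
    \<comment> \<open>Completing the square in \<open>norm x\<close> yields the constant in the
      lower bound.\<close>
    moreover have "0 \<le> (c * norm x - onorm f)\<^sup>2 / c"
      using c by simp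
    moreover have "(c * norm x - onorm f)\<^sup>2 / c
        = c * (norm x)\<^sup>2 - 2 * (onorm f * norm x) + (onorm f)\<^sup>2 / c"
      using c by (simp add: field_simps power2_eq_square)
    ultimately show ?thesis
      unfolding J_def using coercive[of x] by linarith
  qed
  then have bdd: "bdd_below (range J)"
    by (auto intro!: bdd_belowI)
  define m where "m = Inf (range J)"
  have m_le: "m \<le> J x" for x
    unfolding m_def using bdd by (simp add: cINF_lower)
  have "\<exists>x. J x < m + 1 / real (Suc n)" for n
    using cInf_lessD[of "range J" "m + 1 / real (Suc n)"] unfolding m_def by auto
  then obtain X where X: "\<And>n. J (X n) < m + 1 / real (Suc n)"
    by metis
  \<comment> \<open>Parallelogram law for b. The midpoint also has J \<ge> m, so two near-minimisers
    must be close, which makes the minimising sequence Cauchy.\<close>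
  have para: "c * (norm (x - y))\<^sup>2 \<le> 2 * J x + 2 * J y - 4 * m" for x y
  proof -
    define z where "z = (1/2) *\<^sub>R (x + y)"
    have "b (x - y) (x - y) = 2 * J x + 2 * J y - 4 * J z"
      unfolding J_def z_def
      by (simp add: b.add_left b.add_right b.diff_left b.diff_right b.scaleR_left b.scaleR_right
          f.add f.scaleR algebra_simps)
    moreover have "4 * m \<le> 4 * J z"
      using m_le[of z] by simp
    ultimately show ?thesis
      using coercive[of "x - y"] by simp
  qed
  have "Cauchy X"
  proof (rule metric_CauchyI)
    fix e :: real assume e: "e > 0"
    obtain N where N: "1 / real (Suc N) < c * e\<^sup>2 / 4"
      using nat_approx_posE[of "c * e\<^sup>2 / 4"] c e by auto
    have "dist (X i) (X j) < e" if "i \<ge> N" "j \<ge> N" for i j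
    proof -
      have "1 / real (Suc i) \<le> 1 / real (Suc N)" "1 / real (Suc j) \<le> 1 / real (Suc N)"
        using that by (simp_all add: frac_le)
      then have "c * (norm (X i - X j))\<^sup>2 < c * e\<^sup>2"
        using para[of "X i" "X j"] X[of i] X[of j] N by linarith
      then show ?thesis
        using c e by (simp add: dist_norm power_less_imp_less_base)
    qed
    then show "\<exists>N. \<forall>i\<ge>N. \<forall>j\<ge>N. dist (X i) (X j) < e" by blast
  qed
  then obtain u where u: "X \<longlonglongrightarrow> u"
    using Cauchy_convergent convergent_def by blast
  have "(\<lambda>n. J (X n)) \<longlonglongrightarrow> J u"
    unfolding J_def using u by (intro tendsto_intros b.tendsto f.tendsto)
  moreover have "(\<lambda>n. m + 1 / real (Suc n)) \<longlonglongrightarrow> m + 0"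
    using LIMSEQ_inverse_real_of_nat by (intro tendsto_intros) (simp add: inverse_eq_divide)
  ultimately have "J u \<le> m + 0"
    by (rule LIMSEQ_le) (use X less_imp_le in blast)
  then have Ju: "J u \<le> m" by simp
  have "b u y = f y" for y
  proof (rule ccontr)
    assume "b u y \<noteq> f y"
    define d where "d = b u y - f y"
    have d: "d \<noteq> 0" using \<open>b u y \<noteq> f y\<close> by (simp add: d_def)
    then have "y \<noteq> 0" by (auto simp: d_def b.zero_right f.zero)
    then have "c * (norm y)\<^sup>2 > 0" using c by simp
    then have byy: "b y y > 0" using coercive[of y] by linarith
    \<comment> \<open>The minimiser of 2 t d + t^2 \<open>b y y\<close>; moving u by it lowers J by
      d^2 / \<open>b y y\<close>, below the infimum.\<close>
    define t where "t = - d / b y y"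
    have "J (u + t *\<^sub>R y) = J u + 2 * t * d + t\<^sup>2 * b y y"
      using sym[of u y] unfolding J_def d_def
      by (simp add: b.add_left b.add_right b.scaleR_left b.scaleR_right f.add f.scaleR
          algebra_simps power2_eq_square)
    also have "\<dots> = J u - d\<^sup>2 / b y y"
      using byy by (simp add: t_def field_simps power2_eq_square)
    also have "\<dots> < J u"
      using d byy by simp
    also note Ju
    finally show False using m_le[of "u + t *\<^sub>R y"] by simp
  qed
  then show ?thesis using that by blast
qed


subsection \<open>Bounded operators and adjoints\<close>

lemma bounded_clinear_imp_bounded_linear: "bounded_clinear A \<Longrightarrow> bounded_linear A"
  by (simp add: bounded_clinear_def)

lemma bounded_clinear_scaleC: "bounded_clinear A \<Longrightarrow> A (c *\<^sub>C x) = c *\<^sub>C A x"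
  by (simp add: bounded_clinear_def)

lemma bounded_clinear_add: "bounded_clinear A \<Longrightarrow> A (x + y) = A x + A y"
  by (simp add: bounded_clinear_def linear_simps)

lemma bounded_clinear_diff: "bounded_clinear A \<Longrightarrow> A (x - y) = A x - A y"
  by (simp add: bounded_clinear_def linear_simps)

lemma bounded_clinearI:
  assumes "\<And>x y. A (x + y) = A x + A y" "\<And>c x. A (c *\<^sub>C x) = c *\<^sub>C A x"
    and "\<And>x. norm (A x) \<le> norm x * K"
  shows "bounded_clinear A"
  unfolding bounded_clinear_def
  by (auto intro!: bounded_linear_intro[of _ K] simp: assms scaleR_scaleC)

lemma onorm_bounded_clinear: "bounded_clinear A \<Longrightarrow> norm (A x) \<le> onorm A * norm x"
  by (simp add: bounded_clinear_imp_bounded_linear onorm)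

lemma bounded_clinear_compose:
  assumes "bounded_clinear A" "bounded_clinear B"
  shows "bounded_clinear (\<lambda>x. A (B x))"
  using assms unfolding bounded_clinear_def by (auto intro: bounded_linear_compose)

lemma bounded_clinear_plus:
  assumes "bounded_clinear A" "bounded_clinear B"
  shows "bounded_clinear (\<lambda>x. A x + B x)"
  using assms unfolding bounded_clinear_def
  by (auto intro: bounded_linear_add simp: scaleC_add_right)

lemma bounded_clinear_minus:
  assumes "bounded_clinear A" "bounded_clinear B"
  shows "bounded_clinear (\<lambda>x. A x - B x)"
  using assms unfolding bounded_clinear_def
  by (auto intro: bounded_linear_sub simp: scaleC_diff_right)

lemma bounded_clinear_mult_scalar: "bounded_clinear (\<lambda>x::'a::complex_inner. c *\<^sub>C x)"
  by (rule bounded_clinearI[where K = "cmod c"])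
    (simp_all add: scaleC_add_right scaleC_scaleC mult.commute)

text \<open>The adjoint appears as a relation between two functions instead of through
  \<open>cadjoint\<close>, so the bound also serves a polynomial in A and its conjugate
  polynomial.\<close>

lemma adjoint_norm_le:
  assumes A: "bounded_clinear A" and adj: "\<And>x y. cinner (A x) y = cinner x (B y)"
  shows "norm (B y) \<le> norm y * onorm A"
proof (cases "B y = 0")
  case False
  have "(norm (B y))\<^sup>2 = Re (cinner (A (B y)) y)"
    by (simp add: adj Re_cinner_self)
  also have "\<dots> \<le> norm (A (B y)) * norm y"
    by (rule Re_cinner_le)
  also have "\<dots> \<le> onorm A * norm (B y) * norm y"
    by (intro mult_right_mono onorm_bounded_clinear A) simp
  finally show ?thesis
    using False by (simp add: power2_eq_square field_simps)
next
  case True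
  then show ?thesis
    using A by (simp add: bounded_clinear_imp_bounded_linear onorm_pos_le)
qed

lemma bounded_clinear_adjoint:
  assumes A: "bounded_clinear A" and adj: "\<And>x y. cinner (A x) y = cinner x (B y)"
  shows "bounded_clinear B"
proof (rule bounded_clinearI)
  fix y z c
  show "B (y + z) = B y + B z"
    by (rule cinner_ext) (simp add: adj[symmetric] cinner_add_right)
  show "B (c *\<^sub>C y) = c *\<^sub>C B y"
    by (rule cinner_ext) (simp add: adj[symmetric] cinner_scaleC_right)
  show "norm (B y) \<le> norm y * onorm A"
    using assms by (rule adjoint_norm_le)
qed

lemma adjoint_exists:
  fixes A :: "'a::chilbert_space \<Rightarrow> 'b::complex_inner"
  assumes A: "bounded_clinear A"
  obtains B where "\<And>x y. cinner (A x) y = cinner x (B y)"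
proof -
  have "\<exists>u. \<forall>x. Re (cinner (A x) y) = Re (cinner x u)" for y
  proof -
    have "bounded_linear (\<lambda>x. Re (cinner (A x) y))"
      using bounded_linear_compose[OF bounded_bilinear.bounded_linear_left
          [OF bounded_bilinear_Re_cinner] bounded_clinear_imp_bounded_linear[OF A]] .
    then obtain u where "\<And>x. Re (cinner u x) = Re (cinner (A x) y)"
      using coercive_form_represents[OF bounded_bilinear_Re_cinner Re_cinner_commute,
          of 1 "\<lambda>x. Re (cinner (A x) y)"]
      by (auto simp: Re_cinner_self)
    then show ?thesis by (metis Re_cinner_commute)
  qed
  then obtain B where B: "\<And>x y. Re (cinner (A x) y) = Re (cinner x (B y))"
    by metis
  have "cinner (A x) y = cinner x (B y)" for x y
  proof (rule complex_eqI)
    show "Re (cinner (A x) y) = Re (cinner x (B y))" by (rule B)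
    show "Im (cinner (A x) y) = Im (cinner x (B y))"
      \<comment> \<open>Testing at -i x turns the real part into the imaginary part of the product
        at x.\<close>
      using B[of "(- \<i>) *\<^sub>C x" y] by (simp add: bounded_clinear_scaleC[OF A] cinner_scaleC_left)
  qed
  then show ?thesis using that by blast
qed

lemma cadjoint_eqI:
  assumes "\<And>x y. cinner (A x) y = cinner x (B y)"
  shows "cadjoint A = B"
  unfolding cadjoint_def
proof (rule the_equality)
  show "\<forall>x y. cinner (A x) y = cinner x (B y)" using assms by blast
  fix C assume C: "\<forall>x y. cinner (A x) y = cinner x (C y)"
  have "C y = B y" for y
    by (rule cinner_ext) (use C assms in metis)
  then show "C = B" by blast
qed

lemma cinner_cadjoint:
  fixes A :: "'a::chilbert_space \<Rightarrow> 'b::complex_inner"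
  assumes "bounded_clinear A"
  shows "cinner (A x) y = cinner x (cadjoint A y)"
proof -
  obtain B where B: "\<And>x y. cinner (A x) y = cinner x (B y)"
    using adjoint_exists[OF assms] by blast
  from cadjoint_eqI[of A B, OF B] show ?thesis by (simp add: B)
qed

section \<open>Inverses from lower bounds\<close>

definition bounded_below :: "('a::real_normed_vector \<Rightarrow> 'b::real_normed_vector) \<Rightarrow> bool"
  where "bounded_below A \<longleftrightarrow> (\<exists>c>0. \<forall>x. c * norm x \<le> norm (A x))"

lemma bounded_below_compose:
  assumes "bounded_below A" "bounded_below B"
  shows "bounded_below (\<lambda>x. A (B x))"
proof -
  obtain c d where cd: "c > 0" "\<And>x. c * norm x \<le> norm (A x)" "d > 0" "\<And>x. d * norm x \<le> norm (B x)"
    using assms unfolding bounded_below_def by blast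
  have "c * d * norm x \<le> norm (A (B x))" for x
  proof -
    have "c * (d * norm x) \<le> c * norm (B x)"
      using cd by (intro mult_left_mono) auto
    also have "\<dots> \<le> norm (A (B x))" by (rule cd(2))
    finally show ?thesis by (simp add: mult.assoc)
  qed
  then show ?thesis
    unfolding bounded_below_def using cd by (intro exI[of _ "c * d"]) auto
qed

text \<open>The bound below on A gives injectivity and the norm of the inverse. The bound below on
  its adjoint B makes the form <B x, B z> coercive, and representing z \<mapsto> <y, z> by it solves
  A (B u) = y, so no closed-range argument occurs.\<close>

lemma bounded_inverse_exists:
  fixes A :: "'a::complex_inner \<Rightarrow> 'b::chilbert_space"
  assumes A: "bounded_clinear A" and B: "bounded_clinear B"
    and adj: "\<And>x y. cinner (A x) y = cinner x (B y)"
    and "bounded_below A" "bounded_below B"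
  obtains C where "bounded_clinear C" "\<And>x. C (A x) = x" "\<And>y. A (C y) = y"
proof -
  obtain c where c: "c > 0" "\<And>x. c * norm x \<le> norm (A x)"
    using \<open>bounded_below A\<close> unfolding bounded_below_def by blast
  obtain d where d: "d > 0" "\<And>x. d * norm x \<le> norm (B x)"
    using \<open>bounded_below B\<close> unfolding bounded_below_def by blast
  have "\<exists>x. A x = y" for y
  proof -
    have bl: "bounded_bilinear (\<lambda>x z. Re (cinner (B x) (B z)))"
      using B bounded_clinear_imp_bounded_linear bounded_bilinear.comp[OF bounded_bilinear_Re_cinner]
      by blast
    have co: "d\<^sup>2 * (norm x)\<^sup>2 \<le> Re (cinner (B x) (B x))" for x
      unfolding Re_cinner_self power_mult_distrib[symmetric]
      using d by (intro power_mono) auto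
    obtain u where "\<And>x. Re (cinner (B u) (B x)) = Re (cinner y x)"
      using coercive_form_represents[OF bl Re_cinner_commute _ co
          bounded_bilinear.bounded_linear_right[OF bounded_bilinear_Re_cinner, of y]] d
      by auto
    then have "A (B u) = y"
      by (intro Re_cinner_ext) (metis adj Re_cinner_commute)
    then show ?thesis by blast
  qed
  then obtain C where C: "\<And>y. A (C y) = y" by metis
  have inj: "x = z" if "A x = A z" for x z
    using c(2)[of "x - z"] c(1) that by (simp add: bounded_clinear_diff[OF A] mult_le_0_iff)
  have "bounded_clinear C"
  proof (rule bounded_clinearI)
    fix x y k
    show "C (x + y) = C x + C y"
      by (rule inj) (simp add: bounded_clinear_add[OF A] C)
    show "C (k *\<^sub>C x) = k *\<^sub>C C x"
      by (rule inj) (simp add: bounded_clinear_scaleC[OF A] C)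
    show "norm (C x) \<le> norm x * (1 / c)"
      using c(2)[of "C x"] c(1) by (simp add: C field_simps)
  qed
  then show ?thesis using that C inj by metis
qed


subsection \<open>Polynomials in an operator\<close>

lemma poly_op_eq_sum:
  assumes "degree p \<le> n"
  shows "poly_op p A x = (\<Sum>i\<le>n. coeff p i *\<^sub>C (A ^^ i) x)"
  unfolding poly_op_def
  using assms by (intro sum.mono_neutral_left) (auto simp: coeff_eq_0)

lemma poly_op_0 [simp]: "poly_op 0 A x = 0"
  by (simp add: poly_op_def)

text \<open>Horner's rule; with induction over \<open>pCons\<close> it replaces manipulation of the
  sum in the algebraic identities that follow.\<close>

lemma poly_op_pCons:
  assumes "bounded_clinear A"
  shows "poly_op (pCons a p) A x = a *\<^sub>C x + A (poly_op p A x)"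
proof -
  interpret A: bounded_linear A
    using assms by (rule bounded_clinear_imp_bounded_linear)
  have "poly_op (pCons a p) A x
      = (\<Sum>i\<le>Suc (degree p). coeff (pCons a p) i *\<^sub>C (A ^^ i) x)"
    by (intro poly_op_eq_sum degree_pCons_le)
  also have "\<dots> = a *\<^sub>C x + (\<Sum>i\<le>degree p. A (coeff p i *\<^sub>C (A ^^ i) x))"
    unfolding sum.atMost_Suc_shift by (simp add: bounded_clinear_scaleC[OF assms])
  finally show ?thesis
    by (simp add: poly_op_def A.sum)
qed

lemma bounded_clinear_poly_op:
  assumes "bounded_clinear A"
  shows "bounded_clinear (poly_op p A)"
proof (induction p)
  case 0
  show ?case
    by (rule bounded_clinearI[where K = 0]) simp_all
next
  case (pCons a p)
  have "bounded_clinear (\<lambda>x. a *\<^sub>C x + A (poly_op p A x))"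
    by (intro bounded_clinear_plus bounded_clinear_mult_scalar
        bounded_clinear_compose[OF assms pCons.IH])
  then show ?case
    by (simp add: poly_op_pCons[OF assms, abs_def])
qed

lemma poly_op_const: "poly_op [:c:] A x = c *\<^sub>C x"
  by (simp add: poly_op_def)

lemma poly_op_add:
  assumes "bounded_clinear A"
  shows "poly_op (p + q) A x = poly_op p A x + poly_op q A x"
  by (induction p q rule: poly_induct2)
    (simp_all add: poly_op_pCons[OF assms] scaleC_add_left bounded_clinear_add[OF assms])

lemma poly_op_smult:
  assumes "bounded_clinear A"
  shows "poly_op (smult c p) A x = c *\<^sub>C poly_op p A x"
  by (induction p)
    (simp_all add: poly_op_pCons[OF assms] scaleC_scaleC scaleC_add_right
      bounded_clinear_scaleC[OF assms])

lemma poly_op_diff: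
  assumes "bounded_clinear A"
  shows "poly_op (p - q) A x = poly_op p A x - poly_op q A x"
  using poly_op_add[OF assms, of "p - q" q x] by simp

lemma poly_op_mult:
  assumes "bounded_clinear A"
  shows "poly_op (p * q) A x = poly_op p A (poly_op q A x)"
  by (induction p)
    (simp_all add: poly_op_pCons[OF assms] poly_op_add[OF assms] poly_op_smult[OF assms])

lemma cinner_poly_op:
  assumes "bounded_clinear A" and sym: "\<And>x y. cinner (A x) y = cinner x (A y)"
  shows "cinner (poly_op p A x) y = cinner x (poly_op (map_poly cnj p) A y)"
proof -
  \<comment> \<open>Symmetry moves the outer factor A onto y, where it lands inside the conjugate
    polynomial; commutation brings it back outside.\<close>
  have comm: "poly_op p A (A x) = A (poly_op p A x)" for p x
    by (induction p)
      (simp_all add: poly_op_pCons[OF assms(1)] bounded_clinear_add[OF assms(1)]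
        bounded_clinear_scaleC[OF assms(1)] linear_simps(3)[OF bounded_clinear_imp_bounded_linear[OF assms(1)]])
  show ?thesis
    by (induction p arbitrary: x y)
      (simp_all add: map_poly_pCons poly_op_pCons[OF assms(1)] cinner_add_left cinner_add_right
        cinner_scaleC_left cinner_scaleC_right sym comm)
qed

text \<open>Read contrapositively, this is the spectral mapping used later: if p(A) is not bounded
  below, then some root of p is an approximate eigenvalue of A. Splitting off one root at a time
  writes p(A) as a composition of maps bounded below.\<close>

lemma bounded_below_poly_op:
  assumes A: "bounded_clinear A" and "p \<noteq> 0"
    and "\<And>z. poly p z = 0 \<Longrightarrow> bounded_below (\<lambda>x. A x - z *\<^sub>C x)"
  shows "bounded_below (poly_op p A)"
  using assms(2,3)
proof (induction "degree p" arbitrary: p)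
  case 0
  then obtain c where "p = [:c:]" "c \<noteq> 0"
    using degree_0_id by (metis pCons_0_0)
  then show ?case
    by (auto simp: bounded_below_def poly_op_const intro!: exI[of _ "cmod c"])
next
  case (Suc n)
  then have "\<not> constant (poly p)"
    by (simp add: constant_degree)
  then obtain z where z: "poly p z = 0"
    using fundamental_theorem_of_algebra by blast
  then obtain q where q: "p = [:- z, 1:] * q"
    using poly_eq_0_iff_dvd by (meson dvdE)
  have "q \<noteq> 0" using q Suc.prems(1) by auto
  then have "degree p = Suc (degree q)"
    unfolding q by (subst degree_mult_eq) auto
  with Suc have "bounded_below (poly_op q A)"
    using \<open>q \<noteq> 0\<close> by (simp add: q)
  then have "bounded_below (\<lambda>x. A (poly_op q A x) - z *\<^sub>C poly_op q A x)"
    using bounded_below_compose[OF Suc.prems(2)[OF z]] by blast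
  moreover have "poly_op p A = (\<lambda>x. A (poly_op q A x) - z *\<^sub>C poly_op q A x)"
    unfolding q poly_op_mult[OF A, abs_def]
    by (simp add: poly_op_pCons[OF A] scaleC_minus_left
        linear_simps(3)[OF bounded_clinear_imp_bounded_linear[OF A]])
  ultimately show ?case by simp
qed


subsection \<open>Positive operators\<close>

text \<open>Symmetry makes \<open>cinner (P x) x\<close> real, so a condition on its real part is
  full positivity.\<close>

definition positive_op :: "('a::complex_inner \<Rightarrow> 'a) \<Rightarrow> bool"
  where "positive_op P \<longleftrightarrow> bounded_clinear P \<and> (\<forall>x y. cinner (P x) y = cinner x (P y)) \<and>
           (\<forall>x. 0 \<le> Re (cinner (P x) x))"

lemma
  assumes "positive_op P"
  shows positive_op_bounded_clinear: "bounded_clinear P"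
    and positive_op_sym: "cinner (P x) y = cinner x (P y)"
    and positive_op_ge_0: "0 \<le> Re (cinner (P x) x)"
  using assms by (auto simp: positive_op_def)

text \<open>The values <P x, x> at unit vectors lie in [0,R]. If z is at distance at least c from
  that interval, then |<(P - z) x, x>| \<ge> c |x|^2, and Cauchy-Schwarz removes one factor
  |x|.\<close>

lemma positive_op_bounded_below:
  assumes P: "positive_op P" and R: "onorm P \<le> R" and z: "z \<notin> complex_of_real ` {0..R}"
  shows "bounded_below (\<lambda>x. P x - z *\<^sub>C x)"
proof -
  have self: "Im (cinner (P x) x) = 0" for x
    by (metis P cinner_commute positive_op_sym cnj.sel(2) equal_neg_zero)
  have upper: "Re (cinner (P x) x) \<le> R * (norm x)\<^sup>2" for x
  proof -
    have "Re (cinner (P x) x) \<le> norm (P x) * norm x"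
      by (rule Re_cinner_le)
    also have "\<dots> \<le> R * norm x * norm x"
      by (intro mult_right_mono order_trans[OF onorm_bounded_clinear]
          positive_op_bounded_clinear[OF P] R) auto
    finally show ?thesis by (simp add: power2_eq_square)
  qed
  have "\<exists>c>0. \<forall>x. c * (norm x)\<^sup>2 \<le> cmod (cinner (P x - z *\<^sub>C x) x)"
  proof -
    have eq: "cinner (P x - z *\<^sub>C x) x = cinner (P x) x - z * of_real ((norm x)\<^sup>2)" for x
      by (simp add: cinner_diff_left cinner_scaleC_left cinner_self)
    \<comment> \<open>The constant c is the distance in one coordinate direction:
      \<open>\<bar>Im z\<bar>\<close>, - Re z or Re z - R. The fourth case contradicts the choice of
      z.\<close>
    consider "Im z \<noteq> 0" | "Re z < 0" | "R < Re z" | "Im z = 0" "0 \<le> Re z" "Re z \<le> R"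
      by linarith
    then show ?thesis
    proof cases
      case 1
      have "\<bar>Im z\<bar> * (norm x)\<^sup>2 \<le> cmod (cinner (P x - z *\<^sub>C x) x)" for x
        using abs_Im_le_cmod[of "cinner (P x - z *\<^sub>C x) x"]
        by (simp add: eq self abs_mult)
      then show ?thesis using 1 by (intro exI[of _ "\<bar>Im z\<bar>"]) auto
    next
      case 2
      have "- Re z * (norm x)\<^sup>2 \<le> cmod (cinner (P x - z *\<^sub>C x) x)" for x
        using complex_Re_le_cmod[of "cinner (P x - z *\<^sub>C x) x"] positive_op_ge_0[OF P, of x]
        by (simp add: eq)
      then show ?thesis using 2 by (intro exI[of _ "- Re z"]) auto
    next
      case 3
      have "(Re z - R) * (norm x)\<^sup>2 \<le> cmod (cinner (P x - z *\<^sub>C x) x)" for x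
        using abs_Re_le_cmod[of "cinner (P x - z *\<^sub>C x) x"] upper[of x]
        by (simp add: eq left_diff_distrib)
      then show ?thesis using 3 by (intro exI[of _ "Re z - R"]) auto
    next
      case 4
      then have "z = complex_of_real (Re z)" "Re z \<in> {0..R}"
        by (simp_all add: complex_eq_iff)
      then show ?thesis using z by blast
    qed
  qed
  then obtain c where c: "c > 0" "\<And>x. c * (norm x)\<^sup>2 \<le> cmod (cinner (P x - z *\<^sub>C x) x)"
    by blast
  have "c * norm x \<le> norm (P x - z *\<^sub>C x)" for x
  proof (cases "x = 0")
    case False
    have "(c * norm x) * norm x \<le> norm (P x - z *\<^sub>C x) * norm x"
      using order_trans[OF c(2) cmod_cinner_le, of x] by (simp add: power2_eq_square mult.assoc)
    then show ?thesis using False by simp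
  qed simp
  then show ?thesis
    using c(1) unfolding bounded_below_def by blast
qed

lemma spectrum_positive_op:
  fixes P :: "'a::chilbert_space \<Rightarrow> 'a"
  assumes P: "positive_op P" and R: "onorm P \<le> R"
  shows "spectrum P \<subseteq> complex_of_real ` {0..R}"
proof
  fix z assume z: "z \<in> spectrum P"
  show "z \<in> complex_of_real ` {0..R}"
  proof (rule ccontr)
    assume *: "z \<notin> complex_of_real ` {0..R}"
    \<comment> \<open>The adjoint of P - z is P - \<open>cnj z\<close>, and inverting the former
      requires a lower bound for both.\<close>
    have cnj_z: "cnj z \<notin> complex_of_real ` {0..R}"
    proof
      assume "cnj z \<in> complex_of_real ` {0..R}"
      then obtain t where "cnj z = complex_of_real t" "t \<in> {0..R}" by blast
      then have "z = complex_of_real t"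
        by (metis complex_cnj_cnj complex_cnj_complex_of_real)
      with * \<open>t \<in> {0..R}\<close> show False by blast
    qed
    note bb = positive_op_bounded_below[OF P R *] positive_op_bounded_below[OF P R cnj_z]
    note bc = positive_op_bounded_clinear[OF P]
    have "bounded_clinear (\<lambda>x. P x - w *\<^sub>C x)" for w
      by (intro bounded_clinear_minus bc bounded_clinear_mult_scalar)
    moreover have "cinner (P x - z *\<^sub>C x) y = cinner x (P y - cnj z *\<^sub>C y)" for x y
      by (simp add: cinner_diff_left cinner_diff_right cinner_scaleC_left cinner_scaleC_right
          positive_op_sym[OF P])
    ultimately obtain B where "bounded_clinear B" "\<And>x. B (P x - z *\<^sub>C x) = x"
        "\<And>x. P (B x) - z *\<^sub>C B x = x"
      using bounded_inverse_exists[of "\<lambda>x. P x - z *\<^sub>C x" "\<lambda>x. P x - cnj z *\<^sub>C x"] bb by blast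
    then show False using z unfolding spectrum_def by blast
  qed
qed

lemma not_bounded_below_imp_spectrum:
  assumes "\<not> bounded_below (\<lambda>x. A x - z *\<^sub>C x)"
  shows "z \<in> spectrum A"
proof (rule ccontr)
  assume "z \<notin> spectrum A"
  then obtain B where B: "bounded_clinear B" "\<And>x. B (A x - z *\<^sub>C x) = x"
    unfolding spectrum_def by blast
  \<comment> \<open>Adding 1 keeps K positive on the zero space, where \<open>onorm B\<close> is
    0.\<close>
  define K where "K = onorm B + 1"
  have "K > 0"
    using onorm_pos_le[OF bounded_clinear_imp_bounded_linear[OF B(1)]] by (simp add: K_def)
  have "norm x \<le> K * norm (A x - z *\<^sub>C x)" for x
  proof -
    have "norm x \<le> onorm B * norm (A x - z *\<^sub>C x)"
      using onorm_bounded_clinear[OF B(1), of "A x - z *\<^sub>C x"] by (simp add: B(2))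
    also have "\<dots> \<le> K * norm (A x - z *\<^sub>C x)"
      by (intro mult_right_mono) (simp_all add: K_def)
    finally show ?thesis .
  qed
  then have "bounded_below (\<lambda>x. A x - z *\<^sub>C x)"
    unfolding bounded_below_def using \<open>K > 0\<close>
    by (intro exI[of _ "1 / K"]) (auto simp: field_simps)
  then show False using assms by blast
qed

text \<open>If \<open>A\<^sup>*A - \<parallel>A\<parallel>\<^sup>2\<close> were bounded below by \<open>c\<close>, expanding the square of the norm would give
  \<open>\<parallel>A\<parallel>\<^sup>2 \<parallel>A x\<parallel>\<^sup>2 \<le> (\<parallel>A\<parallel>\<^sup>4 - c\<^sup>2) \<parallel>x\<parallel>\<^sup>2\<close>.\<close>

lemma onorm_square_approx_eigenvalue:
  fixes A :: "'a::complex_inner \<Rightarrow> 'b::complex_inner"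
  assumes A: "bounded_clinear A" and adj: "\<And>x y. cinner (A x) y = cinner x (B y)"
    and nontriv: "(e::'a) \<noteq> 0"
  shows "\<not> bounded_below (\<lambda>x. B (A x) - of_real ((onorm A)\<^sup>2) *\<^sub>C x)"
proof
  define N where "N = onorm A"
  assume "bounded_below (\<lambda>x. B (A x) - of_real ((onorm A)\<^sup>2) *\<^sub>C x)"
  then obtain c where c: "c > 0" "\<And>x. c * norm x \<le> norm (B (A x) - of_real (N\<^sup>2) *\<^sub>C x)"
    unfolding bounded_below_def N_def by blast
  have N: "N \<ge> 0"
    unfolding N_def by (intro onorm_pos_le bounded_clinear_imp_bounded_linear A)
  have key: "c\<^sup>2 * (norm x)\<^sup>2 \<le> (N\<^sup>2)\<^sup>2 * (norm x)\<^sup>2 - N\<^sup>2 * (norm (A x))\<^sup>2" for x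
  proof -
    have "c\<^sup>2 * (norm x)\<^sup>2 \<le> (norm (B (A x) - of_real (N\<^sup>2) *\<^sub>C x))\<^sup>2"
      unfolding power_mult_distrib[symmetric] using c by (intro power_mono) auto
    also have "\<dots> = (norm (B (A x)))\<^sup>2 - 2 * N\<^sup>2 * Re (cinner (A x) (A x)) + (N\<^sup>2)\<^sup>2 * (norm x)\<^sup>2"
      using adj[of x "A x"] Re_cinner_commute[of "B (A x)" x]
      by (simp add: norm_diff_square cinner_scaleC_right power_mult_distrib norm_power)
    also have "(norm (B (A x)))\<^sup>2 \<le> (norm (A x) * N)\<^sup>2"
      unfolding N_def using A adj by (intro power_mono adjoint_norm_le) auto
    finally show ?thesis
      by (simp add: Re_cinner_self power_mult_distrib algebra_simps)
  qed
  show False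
  \<comment> \<open>The main case divides by N. There \<open>sqrt K / N\<close> bounds A although K
    < N^4, so A would have norm strictly below N.\<close>
  proof (cases "N = 0")
    case True
    then show ?thesis using key[of e] c(1) nontriv by (simp add: mult_le_0_iff)
  next
    case False
    then have Npos: "N > 0" using N by simp
    define K where "K = (N\<^sup>2)\<^sup>2 - c\<^sup>2"
    have K: "N\<^sup>2 * (norm (A x))\<^sup>2 \<le> K * (norm x)\<^sup>2" for x
      using key[of x] by (simp add: K_def algebra_simps)
    have "0 \<le> N\<^sup>2 * (norm (A e))\<^sup>2" by simp
    also note K[of e]
    finally have K0: "K \<ge> 0" using nontriv by (simp add: zero_le_mult_iff)
    have "norm (A x) \<le> sqrt K / N * norm x" for x
    proof (rule power2_le_imp_le)
      show "(norm (A x))\<^sup>2 \<le> (sqrt K / N * norm x)\<^sup>2"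
        using K[of x] K0 Npos by (simp add: power_mult_distrib power_divide field_simps)
      show "0 \<le> sqrt K / N * norm x" using K0 Npos by simp
    qed
    then have "N \<le> sqrt K / N"
      unfolding N_def using K0 N by (intro onorm_bound) (auto simp: N_def)
    then have "N\<^sup>2 \<le> sqrt K" using Npos by (simp add: field_simps power2_eq_square)
    then have "(N\<^sup>2)\<^sup>2 \<le> (sqrt K)\<^sup>2" by (intro power_mono) auto
    then show False using K0 c(1) by (simp add: K_def)
  qed
qed

text \<open>On the zero space the spectrum is empty and the bound over it is vacuous; there the
  estimate rests on M \<ge> 0.\<close>

lemma onorm_poly_op_le:
  fixes P :: "'a::chilbert_space \<Rightarrow> 'a"
  assumes P: "positive_op P" and M: "M \<ge> 0" "\<And>z. z \<in> spectrum P \<Longrightarrow> cmod (poly p z) \<le> M"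
  shows "onorm (poly_op p P) \<le> M"
proof (cases "\<exists>e::'a. e \<noteq> 0")
  case False
  then have "norm (poly_op p P x) \<le> M * norm x" for x
    by (metis norm_zero mult_zero_right order_refl)
  then show ?thesis
    using M(1) by (intro onorm_bound) auto
next
  case True
  then obtain e :: 'a where e: "e \<noteq> 0" by blast
  note bc = positive_op_bounded_clinear[OF P]
  have root: "\<exists>z\<in>spectrum P. poly r z = 0" if "r \<noteq> 0" "\<not> bounded_below (poly_op r P)" for r
    using bounded_below_poly_op[OF bc \<open>r \<noteq> 0\<close>] that(2) not_bounded_below_imp_spectrum by blast
  define norm_poly where
    "norm_poly q = map_poly cnj q * q - [:of_real ((onorm (poly_op q P))\<^sup>2):]" for q
  have not_bb: "\<not> bounded_below (poly_op (norm_poly q) P)" for q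
  proof -
    have "poly_op (norm_poly q) P = (\<lambda>x. poly_op (map_poly cnj q) P (poly_op q P x)
        - of_real ((onorm (poly_op q P))\<^sup>2) *\<^sub>C x)"
      by (simp add: norm_poly_def fun_eq_iff poly_op_diff[OF bc] poly_op_mult[OF bc] poly_op_const)
    then show ?thesis
      using onorm_square_approx_eigenvalue[OF bounded_clinear_poly_op[OF bc]
          cinner_poly_op[OF bc positive_op_sym[OF P]] e]
      by simp
  qed
  \<comment> \<open>\<open>norm_poly p\<close> may be the zero polynomial, as for constant p. Then
    every spectral value is a root, and one exists because \<open>norm_poly\<close> of the identity
    polynomial is X^2 - N^2, which is nonzero.\<close>
  have "norm_poly [:0, 1:] \<noteq> 0"
    by (simp add: norm_poly_def map_poly_pCons)
  then obtain z\<^sub>0 where "z\<^sub>0 \<in> spectrum P"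
    using root[OF _ not_bb] by blast
  then obtain z where z: "z \<in> spectrum P" "poly (norm_poly p) z = 0"
    using root[OF _ not_bb, of p] by (cases "norm_poly p = 0") auto
  \<comment> \<open>At a real z the polynomial with conjugated coefficients takes the value
    conjugate to that of p, so the root equation reads |p(z)| = |p(P)|.\<close>
  then obtain t where "z = complex_of_real t"
    using spectrum_positive_op[OF P order_refl] by blast
  then have "complex_of_real ((onorm (poly_op p P))\<^sup>2) = complex_of_real ((cmod (poly p z))\<^sup>2)"
    using z(2) complex_norm_square[of "poly p z"]
    by (simp add: norm_poly_def mult.commute)
  then have "(onorm (poly_op p P))\<^sup>2 = (cmod (poly p z))\<^sup>2"
    using of_real_eq_iff by blast
  also have "\<dots> \<le> M\<^sup>2"
    using M z(1) by (intro power_mono) auto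
  finally show ?thesis
    using M(1) by (rule power2_le_imp_le)
qed


subsection \<open>Continuous functions of a positive operator\<close>

text \<open>Real coefficients suffice on a real spectrum and make the operator symmetric.\<close>

definition real_poly_op :: "real poly \<Rightarrow> ('a::complex_inner \<Rightarrow> 'a) \<Rightarrow> 'a \<Rightarrow> 'a"
  where "real_poly_op q A = poly_op (map_poly of_real q) A"

lemma poly_map_poly_of_real:
  "poly (map_poly complex_of_real q) (of_real t) = of_real (poly q t)"
  by (induction q) (simp_all add: map_poly_pCons)

lemma bounded_clinear_real_poly_op:
  "bounded_clinear A \<Longrightarrow> bounded_clinear (real_poly_op q A)"
  by (simp add: real_poly_op_def bounded_clinear_poly_op)

lemma real_poly_op_const: "real_poly_op [:c:] A x = c *\<^sub>R x"
  by (simp add: real_poly_op_def map_poly_pCons poly_op_const scaleR_scaleC)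

lemma real_poly_op_add:
  assumes "bounded_clinear A"
  shows "real_poly_op (p + q) A x = real_poly_op p A x + real_poly_op q A x"
proof -
  have "map_poly complex_of_real (p + q) = map_poly of_real p + map_poly of_real q"
    by (intro poly_eqI) (simp add: coeff_map_poly)
  then show ?thesis
    by (simp add: real_poly_op_def poly_op_add[OF assms])
qed

lemma real_poly_op_diff:
  assumes "bounded_clinear A"
  shows "real_poly_op (p - q) A x = real_poly_op p A x - real_poly_op q A x"
  using real_poly_op_add[OF assms, of "p - q" q x] by simp

lemma real_poly_op_mult:
  assumes "bounded_clinear A"
  shows "real_poly_op (p * q) A x = real_poly_op p A (real_poly_op q A x)"
proof -
  have "map_poly complex_of_real (p * q) = map_poly of_real p * map_poly of_real q"
    by (intro poly_eqI) (simp add: coeff_map_poly coeff_mult)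
  then show ?thesis
    by (simp add: real_poly_op_def poly_op_mult[OF assms])
qed

lemma real_poly_op_smult:
  assumes "bounded_clinear A"
  shows "real_poly_op (smult c p) A x = c *\<^sub>R real_poly_op p A x"
  using real_poly_op_mult[OF assms, of "[:c:]" p x] by (simp add: real_poly_op_const)

lemma cinner_real_poly_op:
  assumes "positive_op P"
  shows "cinner (real_poly_op q P x) y = cinner x (real_poly_op q P y)"
proof -
  have "map_poly cnj (map_poly complex_of_real q) = map_poly of_real q"
    by (intro poly_eqI) (simp add: coeff_map_poly)
  then show ?thesis
    using cinner_poly_op[OF positive_op_bounded_clinear[OF assms] positive_op_sym[OF assms]]
    by (simp add: real_poly_op_def)
qed

lemma onorm_real_poly_op_le:
  fixes P :: "'a::chilbert_space \<Rightarrow> 'a"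
  assumes P: "positive_op P" "onorm P \<le> R" and M: "\<And>t. t \<in> {0..R} \<Longrightarrow> \<bar>poly q t\<bar> \<le> M"
  shows "onorm (real_poly_op q P) \<le> M"
  unfolding real_poly_op_def
proof (rule onorm_poly_op_le[OF P(1)])
  have "0 \<le> R"
    using onorm_pos_le[OF bounded_clinear_imp_bounded_linear[OF positive_op_bounded_clinear]] P
    by (meson order_trans)
  then show "0 \<le> M"
    using M[of 0] by simp
  fix z assume "z \<in> spectrum P"
  then obtain t where "z = complex_of_real t" "t \<in> {0..R}"
    using spectrum_positive_op[OF P] by blast
  then show "cmod (poly (map_poly complex_of_real q) z) \<le> M"
    using M by (simp add: poly_map_poly_of_real)
qed

text \<open>The upper bound \<open>onorm (c - q(P)) \<le> c + e\<close> for large \<open>c\<close> replaces a square root of \<open>q + e\<close>.\<close>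

lemma Re_cinner_real_poly_op_ge:
  fixes P :: "'a::chilbert_space \<Rightarrow> 'a"
  assumes P: "positive_op P" "onorm P \<le> R" and q: "\<And>t. t \<in> {0..R} \<Longrightarrow> - e \<le> poly q t"
  shows "- e * (norm x)\<^sup>2 \<le> Re (cinner (real_poly_op q P x) x)"
proof -
  note bc = positive_op_bounded_clinear[OF P(1)]
  have "compact (poly q ` {0..R})"
    by (intro compact_continuous_image continuous_intros) simp
  then obtain c where c: "\<And>t. t \<in> {0..R} \<Longrightarrow> \<bar>poly q t\<bar> \<le> c"
    by (meson bounded_real compact_imp_bounded imageI)
  \<comment> \<open>On the interval -e \<le> q \<le> c, so c - q lies between 0 and c + e.\<close>
  have le: "onorm (real_poly_op ([:c:] - q) P) \<le> c + e"
  proof (rule onorm_real_poly_op_le[OF P])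
    fix t assume t: "t \<in> {0..R}"
    then show "\<bar>poly ([:c:] - q) t\<bar> \<le> c + e"
      using c[OF t] q[OF t] by simp
  qed
  have "c * (norm x)\<^sup>2 - Re (cinner (real_poly_op q P x) x)
      = Re (cinner (real_poly_op ([:c:] - q) P x) x)"
    by (simp add: real_poly_op_diff[OF bc] real_poly_op_const cinner_diff_left
        cinner_scaleR_left Re_cinner_self)
  also have "\<dots> \<le> norm (real_poly_op ([:c:] - q) P x) * norm x"
    by (rule Re_cinner_le)
  also have "\<dots> \<le> (c + e) * norm x * norm x"
    by (intro mult_right_mono order_trans[OF onorm_bounded_clinear] le
        bounded_clinear_real_poly_op bc) auto
  finally show ?thesis
    by (simp add: power2_eq_square algebra_simps)
qed

section \<open>Weierstrass approximation and norm limits\<close>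

lemma continuous_on_uniform_limit_poly:
  fixes f :: "real \<Rightarrow> real"
  assumes "continuous_on {a..b} f"
  obtains q where "uniform_limit {a..b} (\<lambda>n. poly (q n)) f sequentially"
proof -
  have "\<exists>q. \<forall>t\<in>{a..b}. \<bar>f t - poly q t\<bar> < 1 / real (Suc n)" for n
  proof -
    obtain g where g: "real_polynomial_function g" "\<And>t. t \<in> {a..b} \<Longrightarrow> \<bar>f t - g t\<bar> < 1 / real (Suc n)"
      using Stone_Weierstrass_real_polynomial_function[of "{a..b}" f "1 / real (Suc n)"] assms
      by auto
    then obtain k N where "g = (\<lambda>t. \<Sum>i\<le>N. k i * t ^ i)"
      using real_polynomial_function_iff_sum by blast
    then have "poly (\<Sum>i\<le>N. monom (k i) i) t = g t" for t
      by (simp add: poly_sum poly_monom)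
    then show ?thesis using g(2) by metis
  qed
  then obtain q where q: "\<And>n t. t \<in> {a..b} \<Longrightarrow> \<bar>f t - poly (q n) t\<bar> < 1 / real (Suc n)"
    by metis
  have "uniform_limit {a..b} (\<lambda>n. poly (q n)) f sequentially"
    unfolding uniform_limit_sequentially_iff
  proof (intro allI impI)
    fix e :: real assume "e > 0"
    then obtain N where N: "1 / real (Suc N) < e"
      using nat_approx_posE by blast
    have "dist (poly (q n) t) (f t) < e" if "n \<ge> N" "t \<in> {a..b}" for n t
    proof -
      have "1 / real (Suc n) \<le> 1 / real (Suc N)"
        using that by (simp add: frac_le)
      then show ?thesis
        using q[OF that(2), of n] N by (simp add: dist_real_def)
    qed
    then show "\<exists>N. \<forall>n\<ge>N. \<forall>t\<in>{a..b}. dist (poly (q n) t) (f t) < e" by blast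
  qed
  then show ?thesis using that by blast
qed

text \<open>Completeness is taken from the Banach space of bounded real-linear maps; complex
  homogeneity survives because norm limits are pointwise limits.\<close>

lemma bounded_clinear_limit:
  fixes S :: "nat \<Rightarrow> 'a::complex_inner \<Rightarrow> 'b::chilbert_space"
  assumes S: "\<And>n. bounded_clinear (S n)"
    and Cauchy: "\<And>e. e > 0 \<Longrightarrow> \<exists>N. \<forall>m\<ge>N. \<forall>n\<ge>N. onorm (\<lambda>x. S m x - S n x) < e"
  shows "\<exists>T. bounded_clinear T \<and> (\<lambda>n. onorm (\<lambda>x. S n x - T x)) \<longlonglongrightarrow> 0"
proof -
  define X where "X n = Blinfun (S n)" for n
  have X: "blinfun_apply (X n) = S n" for n
    unfolding X_def by (intro bounded_linear_Blinfun_apply bounded_clinear_imp_bounded_linear S)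
  have norm_diff: "norm (X n - L) = onorm (\<lambda>x. S n x - blinfun_apply L x)" for n L
    by (simp add: norm_blinfun.rep_eq minus_blinfun.rep_eq X)
  have "Cauchy X"
    unfolding Cauchy_def dist_norm norm_diff X using Cauchy by blast
  then obtain L where L: "X \<longlonglongrightarrow> L"
    using Cauchy_convergent convergent_def by blast
  have lim: "(\<lambda>n. S n x) \<longlonglongrightarrow> blinfun_apply L x" for x
    using blinfun.tendsto[OF L tendsto_const[of x]] by (simp add: X)
  have "blinfun_apply L (c *\<^sub>C x) = c *\<^sub>C blinfun_apply L x" for c x
  proof (rule LIMSEQ_unique)
    show "(\<lambda>n. S n (c *\<^sub>C x)) \<longlonglongrightarrow> blinfun_apply L (c *\<^sub>C x)" by (rule lim)
    show "(\<lambda>n. S n (c *\<^sub>C x)) \<longlonglongrightarrow> c *\<^sub>C blinfun_apply L x"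
      unfolding bounded_clinear_scaleC[OF S]
      using bounded_linear.tendsto[OF bounded_clinear_imp_bounded_linear
          [OF bounded_clinear_mult_scalar] lim] .
  qed
  then have "bounded_clinear (blinfun_apply L)"
    by (simp add: bounded_clinear_def blinfun.bounded_linear_right)
  moreover have "(\<lambda>n. onorm (\<lambda>x. S n x - blinfun_apply L x)) \<longlonglongrightarrow> 0"
    using L unfolding norm_diff[symmetric] by (simp add: LIM_zero tendsto_norm_zero)
  ultimately show ?thesis by blast
qed

lemma onorm_limit_unique:
  assumes S: "\<And>n. bounded_clinear (S n)" and T: "bounded_clinear T" "bounded_clinear U"
    and "(\<lambda>n. onorm (\<lambda>x. S n x - T x)) \<longlonglongrightarrow> 0" "(\<lambda>n. onorm (\<lambda>x. S n x - U x)) \<longlonglongrightarrow> 0"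
  shows "T = U"
proof
  fix x
  have lim: "(\<lambda>n. S n x) \<longlonglongrightarrow> V x"
    if "bounded_clinear V" "(\<lambda>n. onorm (\<lambda>x. S n x - V x)) \<longlonglongrightarrow> 0" for V
  proof (rule LIM_zero_cancel, rule Lim_null_comparison)
    show "\<forall>\<^sub>F n in sequentially. norm (S n x - V x) \<le> onorm (\<lambda>x. S n x - V x) * norm x"
      using onorm_bounded_clinear[OF bounded_clinear_minus[OF S that(1)]] by simp
    show "(\<lambda>n. onorm (\<lambda>x. S n x - V x) * norm x) \<longlonglongrightarrow> 0"
      using tendsto_mult_left_zero[OF that(2)] .
  qed
  show "T x = U x"
    using LIMSEQ_unique[OF lim lim] assms by blast
qed

text \<open>The sequence \<open>p\<^sub>0\<close> secures uniqueness: if no polynomial sequence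
  converged, the defining clause would be vacuous.\<close>

lemma cfc_eqI:
  assumes "bounded_clinear T" "bounded_clinear A"
    and "\<And>p. uniform_limit (spectrum A) (\<lambda>n. poly (p n)) f sequentially \<Longrightarrow>
      (\<lambda>n. onorm (\<lambda>x. poly_op (p n) A x - T x)) \<longlonglongrightarrow> 0"
    and "uniform_limit (spectrum A) (\<lambda>n. poly (p\<^sub>0 n)) f sequentially"
  shows "cfc f A = T"
  unfolding cfc_def
proof (rule the_equality, intro conjI allI impI)
  fix U assume U: "bounded_clinear U \<and> (\<forall>p. uniform_limit (spectrum A) (\<lambda>n. poly (p n)) f sequentially
      \<longrightarrow> (\<lambda>n. onorm (\<lambda>x. poly_op (p n) A x - U x)) \<longlonglongrightarrow> 0)"
  with assms show "U = T"
    by (intro onorm_limit_unique[of "\<lambda>n. poly_op (p\<^sub>0 n) A"] bounded_clinear_poly_op) auto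
qed (use assms in auto)

lemma
  fixes P :: "'a::chilbert_space \<Rightarrow> 'a"
  assumes P: "positive_op P" "onorm P \<le> R"
    and q: "uniform_limit {0..R} (\<lambda>n. poly (q n)) f sequentially"
  shows bounded_clinear_cfc: "bounded_clinear (cfc (\<lambda>t. complex_of_real (f (Re t))) P)"
    and cfc_limit: "(\<lambda>n. real_poly_op (q n) P x) \<longlonglongrightarrow> cfc (\<lambda>t. complex_of_real (f (Re t))) P x"
proof -
  note bc = positive_op_bounded_clinear[OF P(1)]
  define F where "F t = complex_of_real (f (Re t))" for t
  have spec: "uniform_limit (spectrum P) (\<lambda>n. poly (map_poly of_real (q n))) F sequentially"
  proof (rule uniform_limit_on_subset[OF _ spectrum_positive_op[OF P]])
    show "uniform_limit (complex_of_real ` {0..R}) (\<lambda>n. poly (map_poly of_real (q n))) F sequentially"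
      using q by (simp add: uniform_limit_iff F_def poly_map_poly_of_real dist_of_real)
  qed
  have diff_le: "onorm (\<lambda>x. poly_op p P x - poly_op p' P x) \<le> e"
    if "e \<ge> 0" "\<forall>z\<in>spectrum P. dist (poly p z) (poly p' z) \<le> e" for p p' e
    using onorm_poly_op_le[OF P(1) that(1), of "p - p'"] that(2)
    by (simp add: dist_norm poly_op_diff[OF bc, abs_def])
  \<comment> \<open>Used twice: with both sequences equal it is the Cauchy property, and with an
    arbitrary p against the chosen q it is independence of the sequence.\<close>
  have close: "\<exists>N. \<forall>m\<ge>N. \<forall>n\<ge>N. onorm (\<lambda>x. poly_op (p m) P x - poly_op (p' n) P x) < e"
    if lim: "uniform_limit (spectrum P) (\<lambda>n. poly (p n)) F sequentially"
      "uniform_limit (spectrum P) (\<lambda>n. poly (p' n)) F sequentially" "e > 0" for p p' e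
  proof -
    \<comment> \<open>Two errors e/4 give a non-strict norm bound e/2, leaving room for the strict
      inequality.\<close>
    have e4: "e / 4 > 0" using lim(3) by simp
    obtain N where N: "\<And>n z. n \<ge> N \<Longrightarrow> z \<in> spectrum P \<Longrightarrow> dist (poly (p n) z) (F z) < e / 4"
      using uniform_limitD[OF lim(1) e4] unfolding eventually_sequentially by blast
    obtain N' where N': "\<And>n z. n \<ge> N' \<Longrightarrow> z \<in> spectrum P \<Longrightarrow> dist (poly (p' n) z) (F z) < e / 4"
      using uniform_limitD[OF lim(2) e4] unfolding eventually_sequentially by blast
    have "onorm (\<lambda>x. poly_op (p m) P x - poly_op (p' n) P x) < e"
      if mn: "m \<ge> max N N'" "n \<ge> max N N'" for m n
    proof -
      have "dist (poly (p m) z) (poly (p' n) z) \<le> e / 2" if "z \<in> spectrum P" for z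
        using N[OF _ that, of m] N'[OF _ that, of n] mn
          dist_triangle2[of "poly (p m) z" "poly (p' n) z" "F z"] by simp
      then have "onorm (\<lambda>x. poly_op (p m) P x - poly_op (p' n) P x) \<le> e / 2"
        using e4 by (intro diff_le) auto
      then show ?thesis using e4 by simp
    qed
    then show ?thesis by blast
  qed
  have "\<exists>T. bounded_clinear T \<and> (\<lambda>n. onorm (\<lambda>x. real_poly_op (q n) P x - T x)) \<longlonglongrightarrow> 0"
  proof (rule bounded_clinear_limit[of "\<lambda>n. real_poly_op (q n) P"])
    fix e :: real assume "e > 0"
    then show "\<exists>N. \<forall>m\<ge>N. \<forall>n\<ge>N. onorm (\<lambda>x. real_poly_op (q m) P x - real_poly_op (q n) P x) < e"
      unfolding real_poly_op_def by (rule close[OF spec spec])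
  qed (rule bounded_clinear_real_poly_op[OF bc])
  then obtain T where T: "bounded_clinear T"
      "(\<lambda>n. onorm (\<lambda>x. real_poly_op (q n) P x - T x)) \<longlonglongrightarrow> 0"
    by blast
  have "cfc F P = T"
  proof (rule cfc_eqI[OF T(1) bc _ spec])
    fix p assume p: "uniform_limit (spectrum P) (\<lambda>n. poly (p n)) F sequentially"
    have diff: "(\<lambda>n. onorm (\<lambda>x. poly_op (p n) P x - real_poly_op (q n) P x)) \<longlonglongrightarrow> 0"
    proof (rule metric_LIMSEQ_I)
      fix e :: real assume e: "e > 0"
      obtain N where N: "\<And>n. n \<ge> N \<Longrightarrow> onorm (\<lambda>x. poly_op (p n) P x - real_poly_op (q n) P x) < e"
        using close[OF p spec e] unfolding real_poly_op_def by blast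
      have "0 \<le> onorm (\<lambda>x. poly_op (p n) P x - real_poly_op (q n) P x)" for n
        by (intro onorm_pos_le bounded_clinear_imp_bounded_linear bounded_clinear_minus
            bounded_clinear_poly_op bounded_clinear_real_poly_op bc)
      then show "\<exists>N. \<forall>n\<ge>N. dist (onorm (\<lambda>x. poly_op (p n) P x - real_poly_op (q n) P x)) 0 < e"
        using N by (auto simp: dist_real_def)
    qed
    show "(\<lambda>n. onorm (\<lambda>x. poly_op (p n) P x - T x)) \<longlonglongrightarrow> 0"
    proof (rule Lim_null_comparison)
      show "\<forall>\<^sub>F n in sequentially. norm (onorm (\<lambda>x. poly_op (p n) P x - T x))
          \<le> onorm (\<lambda>x. poly_op (p n) P x - real_poly_op (q n) P x)
            + onorm (\<lambda>x. real_poly_op (q n) P x - T x)"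
      proof (intro always_eventually allI)
        fix n
        have bl: "bounded_linear (\<lambda>x. poly_op (p n) P x - T x)"
          "bounded_linear (\<lambda>x. poly_op (p n) P x - real_poly_op (q n) P x)"
          "bounded_linear (\<lambda>x. real_poly_op (q n) P x - T x)"
          by (intro bounded_clinear_imp_bounded_linear bounded_clinear_minus T(1)
              bounded_clinear_poly_op bounded_clinear_real_poly_op bc)+
        show "norm (onorm (\<lambda>x. poly_op (p n) P x - T x))
          \<le> onorm (\<lambda>x. poly_op (p n) P x - real_poly_op (q n) P x)
            + onorm (\<lambda>x. real_poly_op (q n) P x - T x)"
          using onorm_triangle[OF bl(2,3)] onorm_pos_le[OF bl(1)] by simp
      qed
      show "(\<lambda>n. onorm (\<lambda>x. poly_op (p n) P x - real_poly_op (q n) P x)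
            + onorm (\<lambda>x. real_poly_op (q n) P x - T x)) \<longlonglongrightarrow> 0"
        using tendsto_add[OF diff T(2)] by simp
    qed
  qed
  then have eq: "cfc (\<lambda>t. complex_of_real (f (Re t))) P = T"
    by (simp add: F_def[abs_def])
  show "bounded_clinear (cfc (\<lambda>t. complex_of_real (f (Re t))) P)"
    using T(1) by (simp add: eq)
  have bc_diff: "bounded_clinear (\<lambda>x. real_poly_op (q n) P x - T x)" for n
    by (intro bounded_clinear_minus bounded_clinear_real_poly_op bc T(1))
  show "(\<lambda>n. real_poly_op (q n) P x) \<longlonglongrightarrow> cfc (\<lambda>t. complex_of_real (f (Re t))) P x"
    unfolding eq
  proof (rule LIM_zero_cancel, rule Lim_null_comparison)
    show "\<forall>\<^sub>F n in sequentially. norm (real_poly_op (q n) P x - T x)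
        \<le> onorm (\<lambda>x. real_poly_op (q n) P x - T x) * norm x"
      using onorm_bounded_clinear[OF bc_diff] by simp
    show "(\<lambda>n. onorm (\<lambda>x. real_poly_op (q n) P x - T x) * norm x) \<longlonglongrightarrow> 0"
      using tendsto_mult_left_zero[OF T(2)] .
  qed
qed


subsection \<open>Powers of a positive operator\<close>

text \<open>Unlike for \<open>powr\<close>, \<open>0\<^sup>0 = 1\<close> here.\<close>

definition cpowr :: "real \<Rightarrow> real \<Rightarrow> real"
  where "cpowr s t = (if s = 0 then 1 else t powr s)"

lemma op_powr_eq_cfc: "op_powr P s = cfc (\<lambda>t. complex_of_real (cpowr s (Re t))) P"
  by (simp add: op_powr_def cpowr_def)

lemma continuous_on_cpowr:
  assumes "s \<ge> 0"
  shows "continuous_on {0..R} (cpowr s)"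
proof (cases "s = 0")
  case True
  then have "cpowr s = (\<lambda>_. 1)" by (simp add: cpowr_def fun_eq_iff)
  then show ?thesis by simp
next
  case False
  then have "cpowr s = (\<lambda>t. t powr s)" by (simp add: cpowr_def fun_eq_iff)
  then show ?thesis
    using assms False by (simp, intro continuous_on_powr') (auto intro: continuous_intros)
qed

lemma cpowr_mult_self: "cpowr s t * cpowr s t = cpowr (2 * s) t"
  by (simp add: cpowr_def powr_add[symmetric])

lemma cpowr_poly_approximation:
  assumes "s \<ge> 0"
  obtains q where "uniform_limit {0..R} (\<lambda>n. poly (q n)) (cpowr s) sequentially"
  using continuous_on_uniform_limit_poly[OF continuous_on_cpowr[OF assms]] by blast

lemma bounded_clinear_op_powr:
  fixes P :: "'a::chilbert_space \<Rightarrow> 'a"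
  assumes "positive_op P" "s \<ge> 0"
  shows "bounded_clinear (op_powr P s)"
proof -
  obtain q where "uniform_limit {0..onorm P} (\<lambda>n. poly (q n)) (cpowr s) sequentially"
    using cpowr_poly_approximation[OF assms(2)] by blast
  then show ?thesis
    unfolding op_powr_eq_cfc by (rule bounded_clinear_cfc[OF assms(1) order_refl])
qed

lemma op_powr_limit:
  fixes P :: "'a::chilbert_space \<Rightarrow> 'a"
  assumes "positive_op P" "onorm P \<le> R"
    and "uniform_limit {0..R} (\<lambda>n. poly (q n)) (cpowr s) sequentially"
  shows "(\<lambda>n. real_poly_op (q n) P x) \<longlonglongrightarrow> op_powr P s x"
  unfolding op_powr_eq_cfc using assms by (rule cfc_limit)

text \<open>Positivity of the calculus: approximants of h \<ge> 0 are eventually \<ge> -e. The limit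
  l stands for <h(P) x, x>, so h can be a combination of powers without h(P) being identified as an
  operator.\<close>

lemma Re_cinner_limit_nonneg:
  fixes P :: "'a::chilbert_space \<Rightarrow> 'a"
  assumes P: "positive_op P" "onorm P \<le> R"
    and q: "uniform_limit {0..R} (\<lambda>n. poly (q n)) h sequentially"
    and h: "\<And>t. t \<in> {0..R} \<Longrightarrow> 0 \<le> h t"
    and lim: "(\<lambda>n. Re (cinner (real_poly_op (q n) P x) x)) \<longlonglongrightarrow> l"
  shows "0 \<le> l"
proof -
  have "- e * (norm x)\<^sup>2 \<le> l" if e: "e > 0" for e
  proof (rule tendsto_lowerbound[OF lim])
    show "\<forall>\<^sub>F n in sequentially. - e * (norm x)\<^sup>2 \<le> Re (cinner (real_poly_op (q n) P x) x)"
      using uniform_limitD[OF q e]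
    proof eventually_elim
      case (elim n)
      show ?case
      proof (rule Re_cinner_real_poly_op_ge[OF P])
        fix t assume t: "t \<in> {0..R}"
        show "- e \<le> poly (q n) t"
          using bspec[OF elim t] h[OF t] by (simp add: dist_real_def)
      qed
    qed
  qed simp
  moreover have "((\<lambda>e. - e * (norm x)\<^sup>2) \<longlongrightarrow> - 0 * (norm x)\<^sup>2) (at_right 0)"
    by (intro tendsto_intros)
  ultimately show ?thesis
    using tendsto_upperbound[of "\<lambda>e. - e * (norm x)\<^sup>2" 0 "at_right 0" l]
    by (simp add: eventually_at_right_less eventually_mono[OF eventually_at_right_less])
qed

lemma op_powr_sym:
  fixes P :: "'a::chilbert_space \<Rightarrow> 'a"
  assumes P: "positive_op P" and s: "s \<ge> 0"
  shows "cinner (op_powr P s x) y = cinner x (op_powr P s y)"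
proof -
  obtain q where q: "uniform_limit {0..onorm P} (\<lambda>n. poly (q n)) (cpowr s) sequentially"
    using cpowr_poly_approximation[OF s] by blast
  note lim = op_powr_limit[OF P order_refl q]
  have "(\<lambda>n. cinner (real_poly_op (q n) P x) y) \<longlonglongrightarrow> cinner (op_powr P s x) y"
    using bounded_bilinear.tendsto[OF bounded_bilinear_cinner lim tendsto_const] .
  moreover have "(\<lambda>n. cinner (real_poly_op (q n) P x) y) \<longlonglongrightarrow> cinner x (op_powr P s y)"
    unfolding cinner_real_poly_op[OF P]
    using bounded_bilinear.tendsto[OF bounded_bilinear_cinner tendsto_const lim] .
  ultimately show ?thesis by (rule LIMSEQ_unique)
qed

text \<open>The squares of polynomials approximating t^s approximate t^(2s), uniformly because t^s
  is bounded on the interval.\<close>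

lemma norm_op_powr_square:
  fixes P :: "'a::chilbert_space \<Rightarrow> 'a"
  assumes P: "positive_op P" and s: "s \<ge> 0"
  shows "(norm (op_powr P s x))\<^sup>2 = Re (cinner (op_powr P (2 * s) x) x)"
proof -
  obtain q where q: "uniform_limit {0..onorm P} (\<lambda>n. poly (q n)) (cpowr s) sequentially"
    using cpowr_poly_approximation[OF s] by blast
  have "bounded (cpowr s ` {0..onorm P})"
    by (intro compact_imp_bounded compact_continuous_image continuous_on_cpowr s) simp
  then have "uniform_limit {0..onorm P} (\<lambda>n t. poly (q n) t * poly (q n) t)
      (\<lambda>t. cpowr s t * cpowr s t) sequentially"
    using uniform_lim_mult[OF q q] by blast
  moreover have "(\<lambda>n t. poly (q n) t * poly (q n) t) = (\<lambda>n. poly (q n * q n))"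
    by (simp add: fun_eq_iff)
  moreover have "(\<lambda>t. cpowr s t * cpowr s t) = cpowr (2 * s)"
    by (simp add: fun_eq_iff cpowr_mult_self)
  ultimately have "uniform_limit {0..onorm P} (\<lambda>n. poly (q n * q n)) (cpowr (2 * s)) sequentially"
    by (simp only:)
  note lim2 = op_powr_limit[OF P order_refl this]
  note lim = op_powr_limit[OF P order_refl q]
  have "(\<lambda>n. Re (cinner (real_poly_op (q n) P x) (real_poly_op (q n) P x)))
      \<longlonglongrightarrow> Re (cinner (op_powr P s x) (op_powr P s x))"
    by (intro tendsto_Re_cinner lim)
  moreover have "(\<lambda>n. Re (cinner (real_poly_op (q n) P x) (real_poly_op (q n) P x)))
      \<longlonglongrightarrow> Re (cinner (op_powr P (2 * s) x) x)"
    using tendsto_Re_cinner[OF lim2 tendsto_const, of x x]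
    by (simp add: real_poly_op_mult[OF positive_op_bounded_clinear[OF P]] cinner_real_poly_op[OF P])
  ultimately show ?thesis
    unfolding Re_cinner_self by (rule LIMSEQ_unique)
qed

text \<open>The sign comes from <P^s x, x> = |P^(s/2) x|^2.\<close>

lemma positive_op_powr:
  fixes P :: "'a::chilbert_space \<Rightarrow> 'a"
  assumes "positive_op P" "s \<ge> 0"
  shows "positive_op (op_powr P s)"
  unfolding positive_op_def
  using bounded_clinear_op_powr[OF assms] op_powr_sym[OF assms]
    norm_op_powr_square[OF assms(1), of "s / 2"] assms(2)
  by (metis (no_types) divide_nonneg_pos nonzero_mult_div_cancel_left times_divide_eq_right
      zero_le_power2 zero_less_numeral zero_neq_numeral)

text \<open>The tangent of \<open>u \<mapsto> u\<^bsup>s/r\<^esup>\<close> at \<open>u = M\<close>, evaluated at \<open>u = t\<^sup>r\<close>.\<close>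

lemma cpowr_le_tangent:
  assumes s: "0 \<le> s" "s \<le> r" "0 < r" and "M > 0" "t \<ge> 0"
  shows "cpowr s t \<le> M powr (s / r - 1) * (s / r * cpowr r t + (1 - s / r) * M)"
proof -
  define \<theta> where "\<theta> = s / r"
  have \<theta>: "0 \<le> \<theta>" "\<theta> \<le> 1" and s_eq: "s = r * \<theta>"
    using s by (simp_all add: \<theta>_def)
  have M: "M powr (\<theta> - 1) * M powr (1 - \<theta>) = 1"
    using \<open>M > 0\<close> by (simp add: powr_add[symmetric])
  have "cpowr s t \<le> M powr (\<theta> - 1) * (\<theta> * cpowr r t + (1 - \<theta>) * M)"
  proof (cases "s = 0")
    case True
    then have "\<theta> = 0" by (simp add: \<theta>_def)
    then show ?thesis
      using M \<open>M > 0\<close> True by (simp add: cpowr_def)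
  next
    case sn: False
    show ?thesis
    proof (cases "t = 0")
      case True
      then show ?thesis
        using sn s \<theta> \<open>M > 0\<close> by (simp add: cpowr_def)
    next
      case False
      then have "t > 0" using \<open>t \<ge> 0\<close> by simp
      \<comment> \<open>Young's inequality with weights \<theta> and 1 - \<theta> is the
        tangent-line bound multiplied by M^(1-\<theta>).\<close>
      have "(t powr r) powr \<theta> * M powr (1 - \<theta>) \<le> \<theta> * t powr r + (1 - \<theta>) * M"
        using \<theta> \<open>t > 0\<close> \<open>M > 0\<close> by (intro Youngs_inequality_0) auto
      then have "M powr (\<theta> - 1) * (t powr s * M powr (1 - \<theta>))
          \<le> M powr (\<theta> - 1) * (\<theta> * t powr r + (1 - \<theta>) * M)"
        by (intro mult_left_mono) (simp_all add: powr_powr s_eq)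
      moreover have "M powr (\<theta> - 1) * (t powr s * M powr (1 - \<theta>)) = t powr s"
        using M by (simp add: mult.left_commute)
      ultimately show ?thesis
        using sn s by (simp add: cpowr_def)
    qed
  qed
  then show ?thesis by (simp add: \<theta>_def)
qed

text \<open>McCarthy's inequality: t^s lies below the line c t^r + d, positivity transfers this to
  quadratic forms, and the unit vector turns the constant term into d.\<close>

lemma Re_cinner_op_powr_le:
  fixes P :: "'a::chilbert_space \<Rightarrow> 'a"
  assumes P: "positive_op P" and s: "0 \<le> s" "s \<le> r" "0 < r" and x: "norm x = 1"
    and M: "0 < M" "Re (cinner (op_powr P r x) x) \<le> M"
  shows "Re (cinner (op_powr P s x) x) \<le> M powr (s / r)"
proof -
  define \<theta> where "\<theta> = s / r"
  define c where "c = M powr (\<theta> - 1) * \<theta>"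
  define d where "d = M powr (\<theta> - 1) * ((1 - \<theta>) * M)"
  note bc = positive_op_bounded_clinear[OF P]
  obtain p where p: "uniform_limit {0..onorm P} (\<lambda>n. poly (p n)) (cpowr s) sequentially"
    using cpowr_poly_approximation[OF s(1)] by blast
  obtain q where q: "uniform_limit {0..onorm P} (\<lambda>n. poly (q n)) (cpowr r) sequentially"
    using cpowr_poly_approximation[of r] s(3) by (meson less_imp_le)
  define h where "h n = smult c (q n) + [:d:] - p n" for n
  have "uniform_limit {0..onorm P} (\<lambda>n t. c * poly (q n) t + d - poly (p n) t)
      (\<lambda>t. c * cpowr r t + d - cpowr s t) sequentially"
    by (intro uniform_limit_intros p q)
  then have h: "uniform_limit {0..onorm P} (\<lambda>n. poly (h n))
      (\<lambda>t. c * cpowr r t + d - cpowr s t) sequentially"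
    by (simp add: h_def fun_eq_iff cong: uniform_limit_cong')
  have "(\<lambda>n. Re (cinner (real_poly_op (h n) P x) x)) \<longlonglongrightarrow>
      c * Re (cinner (op_powr P r x) x) + d - Re (cinner (op_powr P s x) x)"
    unfolding h_def real_poly_op_diff[OF bc] real_poly_op_add[OF bc] real_poly_op_smult[OF bc]
      real_poly_op_const cinner_diff_left cinner_add_left cinner_scaleR_left
    using tendsto_Re_cinner[OF op_powr_limit[OF P order_refl p] tendsto_const, of x x]
      tendsto_Re_cinner[OF op_powr_limit[OF P order_refl q] tendsto_const, of x x]
    by (auto simp: cinner_self x intro!: tendsto_intros)
  then have "0 \<le> c * Re (cinner (op_powr P r x) x) + d - Re (cinner (op_powr P s x) x)"
  proof (rule Re_cinner_limit_nonneg[OF P order_refl h, rotated])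
    fix t assume "t \<in> {0..onorm P}"
    then show "0 \<le> c * cpowr r t + d - cpowr s t"
      using cpowr_le_tangent[OF s M(1), of t] by (simp add: c_def d_def \<theta>_def algebra_simps)
  qed
  moreover have "c * Re (cinner (op_powr P r x) x) \<le> c * M"
    using M s by (intro mult_left_mono) (auto simp: c_def \<theta>_def)
  \<comment> \<open>The line touches the curve u \<mapsto> u^\<theta> at u = M.\<close>
  moreover have "c * M + d = M powr \<theta>"
  proof -
    have "c * M + d = M powr (\<theta> - 1) * M"
      by (simp add: c_def d_def algebra_simps)
    then show ?thesis
      using powr_add[of M "\<theta> - 1" 1] M(1) by simp
  qed
  ultimately show ?thesis by (simp add: \<theta>_def)
qed

text \<open>McCarthy's inequality at exponent 2 s, raised to the power r/2. The condition 2 s \<le>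
  r is where r \<ge> 2 enters, for s = \<alpha> and s = 1 - \<alpha> alike.\<close>

lemma norm_op_powr_powr_le:
  fixes P :: "'a::chilbert_space \<Rightarrow> 'a"
  assumes P: "positive_op P" and s: "0 \<le> s" "2 * s \<le> r" "0 < r" and x: "norm x = 1"
    and M: "0 < M" "Re (cinner (op_powr P r x) x) \<le> M"
  shows "norm (op_powr P s x) powr r \<le> M powr s"
proof -
  let ?a = "norm (op_powr P s x)"
  have "?a\<^sup>2 \<le> M powr (2 * s / r)"
    unfolding norm_op_powr_square[OF P s(1)] using assms by (intro Re_cinner_op_powr_le) auto
  then have "(?a\<^sup>2) powr (r / 2) \<le> (M powr (2 * s / r)) powr (r / 2)"
    using s by (intro powr_mono2) auto
  moreover have "(?a\<^sup>2) powr (r / 2) = ?a powr r"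
    by (simp add: powr_powr powr_numeral[symmetric] del: powr_numeral)
  moreover have "(M powr (2 * s / r)) powr (r / 2) = M powr s"
    using s by (simp add: powr_powr)
  ultimately show ?thesis by simp
qed

section \<open>The weighted estimate at a unit vector\<close>

lemma numerical_range_weighted_bound:
  fixes P Q Y :: "'a::chilbert_space \<Rightarrow> 'a"
  assumes P: "positive_op P" and Q: "positive_op Q"
    and Y: "\<And>x. norm (Y x) \<le> K * norm x"
    and r: "r \<ge> 2" and \<alpha>: "0 \<le> \<alpha>" "\<alpha> \<le> 1" and x: "norm x = 1"
  shows "cmod (cinner (op_powr P \<alpha> (Y (op_powr Q (1 - \<alpha>) x))) x) powr r
    \<le> K powr r * (\<alpha> * Re (cinner (op_powr P r x) x) + (1 - \<alpha>) * Re (cinner (op_powr Q r x) x))"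
proof -
  define m n where "m = Re (cinner (op_powr P r x) x)" and "n = Re (cinner (op_powr Q r x) x)"
  define a b where "a = norm (op_powr P \<alpha> x)" and "b = norm (op_powr Q (1 - \<alpha>) x)"
  have K: "K \<ge> 0"
    using Y[of x] x norm_ge_zero[of "Y x"] by (simp del: norm_ge_zero)
  have mn: "m \<ge> 0" "n \<ge> 0"
    unfolding m_def n_def using r
    by (auto intro!: positive_op_ge_0 positive_op_powr P Q)
  have "cmod (cinner (op_powr P \<alpha> (Y (op_powr Q (1 - \<alpha>) x))) x)
      = cmod (cinner (Y (op_powr Q (1 - \<alpha>) x)) (op_powr P \<alpha> x))"
    by (simp add: op_powr_sym[OF P \<alpha>(1)])
  also have "\<dots> \<le> norm (Y (op_powr Q (1 - \<alpha>) x)) * a"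
    unfolding a_def by (rule cmod_cinner_le)
  also have "\<dots> \<le> K * b * a"
    unfolding b_def by (intro mult_right_mono Y) (simp add: a_def)
  finally have "cmod (cinner (op_powr P \<alpha> (Y (op_powr Q (1 - \<alpha>) x))) x) powr r
      \<le> (K * b * a) powr r"
    using r by (intro powr_mono2) auto
  also have "\<dots> = K powr r * (a powr r * b powr r)"
    by (simp add: powr_mult K a_def b_def mult_ac)
  also have "a powr r * b powr r \<le> \<alpha> * m + (1 - \<alpha>) * n"
  \<comment> \<open>m or n may be 0, while the power bounds need a positive M; m + e and n + e serve
    instead. The weights sum to 1, so the total error is exactly e.\<close>
  proof (rule field_le_epsilon)
    fix e :: real assume e: "e > 0"
    have a: "a powr r \<le> (m + e) powr \<alpha>"
      unfolding a_def using mn e r \<alpha> x by (intro norm_op_powr_powr_le[OF P]) (auto simp: m_def)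
    have b: "b powr r \<le> (n + e) powr (1 - \<alpha>)"
      unfolding b_def using mn e r \<alpha> x by (intro norm_op_powr_powr_le[OF Q]) (auto simp: n_def)
    have "a powr r * b powr r \<le> (m + e) powr \<alpha> * (n + e) powr (1 - \<alpha>)"
      using a b by (intro mult_mono) auto
    also have "\<dots> \<le> \<alpha> * (m + e) + (1 - \<alpha>) * (n + e)"
      using mn e \<alpha> by (intro Youngs_inequality_0) auto
    also have "\<dots> = \<alpha> * m + (1 - \<alpha>) * n + e"
      by (simp add: algebra_simps)
    finally show "a powr r * b powr r \<le> \<alpha> * m + (1 - \<alpha>) * n + e" .
  qed
  finally show ?thesis
    by (simp add: m_def n_def mult_left_mono)
qed


subsection \<open>Diagonal operators on a direct sum\<close>

lemma positive_op_map_prod: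
  assumes "positive_op S" "positive_op T"
  shows "positive_op (map_prod S T)"
proof -
  note bS = positive_op_bounded_clinear[OF assms(1)] and bT = positive_op_bounded_clinear[OF assms(2)]
  have eq: "map_prod S T = (\<lambda>v. (S (fst v), T (snd v)))"
    by (auto simp: fun_eq_iff)
  have "bounded_linear (\<lambda>v. (S (fst v), T (snd v)))"
    by (intro bounded_linear_Pair bounded_linear_compose[OF bounded_clinear_imp_bounded_linear[OF bS]]
        bounded_linear_compose[OF bounded_clinear_imp_bounded_linear[OF bT]]
        bounded_linear_fst bounded_linear_snd)
  then have "bounded_clinear (map_prod S T)"
    by (simp add: eq bounded_clinear_def scaleC_prod_def
        bounded_clinear_scaleC[OF bS] bounded_clinear_scaleC[OF bT])
  then show ?thesis
    using assms by (auto simp: positive_op_def cinner_prod_def)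
qed

lemma poly_op_map_prod:
  assumes "positive_op S" "positive_op T"
  shows "poly_op p (map_prod S T) (x, y) = (poly_op p S x, poly_op p T y)"
  by (induction p)
    (simp_all add: poly_op_pCons positive_op_bounded_clinear positive_op_map_prod assms
      scaleC_prod_def zero_prod_def)

text \<open>Polynomials act componentwise, and with R above all three norms the same polynomials
  converge to all three powers.\<close>

lemma op_powr_map_prod:
  fixes S :: "'a::chilbert_space \<Rightarrow> 'a" and T :: "'b::chilbert_space \<Rightarrow> 'b"
  assumes S: "positive_op S" and T: "positive_op T" and s: "s \<ge> 0"
  shows "op_powr (map_prod S T) s = map_prod (op_powr S s) (op_powr T s)"
proof -
  define R where "R = max (onorm (map_prod S T)) (max (onorm S) (onorm T))"
  have R: "onorm (map_prod S T) \<le> R" "onorm S \<le> R" "onorm T \<le> R"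
    by (simp_all add: R_def)
  obtain q where q: "uniform_limit {0..R} (\<lambda>n. poly (q n)) (cpowr s) sequentially"
    using cpowr_poly_approximation[OF s] by blast
  have "op_powr (map_prod S T) s (x, y) = (op_powr S s x, op_powr T s y)" for x y
  proof (rule LIMSEQ_unique)
    show "(\<lambda>n. real_poly_op (q n) (map_prod S T) (x, y)) \<longlonglongrightarrow> op_powr (map_prod S T) s (x, y)"
      by (rule op_powr_limit[OF positive_op_map_prod[OF S T] R(1) q])
    show "(\<lambda>n. real_poly_op (q n) (map_prod S T) (x, y)) \<longlonglongrightarrow> (op_powr S s x, op_powr T s y)"
      unfolding real_poly_op_def poly_op_map_prod[OF S T]
      using op_powr_limit[OF S R(2) q, of x] op_powr_limit[OF T R(3) q, of y]
      by (auto simp: real_poly_op_def intro: tendsto_Pair)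
  qed
  then show ?thesis by (auto simp: fun_eq_iff)
qed

lemma positive_op_cadjoint_compose:
  fixes A :: "'a::chilbert_space \<Rightarrow> 'b::chilbert_space"
  assumes "bounded_clinear A"
  shows "positive_op (cadjoint A \<circ> A)"
proof -
  note adj = cinner_cadjoint[OF assms]
  have "bounded_clinear (cadjoint A \<circ> A)"
    unfolding comp_def by (rule bounded_clinear_compose[OF bounded_clinear_adjoint[OF assms adj] assms])
  moreover have "cinner (cadjoint A y) x = cinner y (A x)" for x y
    by (metis adj cinner_commute)
  ultimately show ?thesis
    by (simp add: positive_op_def adj[symmetric] cinner_ge_zero)
qed

lemma positive_op_abs:
  fixes A :: "'a::chilbert_space \<Rightarrow> 'a"
  assumes "bounded_clinear A"
  shows "positive_op (op_abs A)"
  unfolding op_abs_def by (intro positive_op_powr positive_op_cadjoint_compose assms) simp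

text \<open>The first coordinate is fed to \<open>A\<^sub>2\<close> and the second to
  \<open>A\<^sub>1\<close>, so the indices appear swapped on the diagonal.\<close>

lemma op_abs_off_diagonal:
  fixes A\<^sub>1 A\<^sub>2 :: "'a::chilbert_space \<Rightarrow> 'a"
  assumes A: "bounded_clinear A\<^sub>1" "bounded_clinear A\<^sub>2"
  shows "op_abs (block_op (\<lambda>_. 0) A\<^sub>1 A\<^sub>2 (\<lambda>_. 0)) = map_prod (op_abs A\<^sub>2) (op_abs A\<^sub>1)"
proof -
  have "cadjoint (block_op (\<lambda>_. 0) A\<^sub>1 A\<^sub>2 (\<lambda>_. 0))
      = block_op (\<lambda>_. 0) (cadjoint A\<^sub>2) (cadjoint A\<^sub>1) (\<lambda>_. 0)"
    by (rule cadjoint_eqI) (auto simp: block_op_def cinner_prod_def cinner_cadjoint A)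
  then have "cadjoint (block_op (\<lambda>_. 0) A\<^sub>1 A\<^sub>2 (\<lambda>_. 0)) \<circ> block_op (\<lambda>_. 0) A\<^sub>1 A\<^sub>2 (\<lambda>_. 0)
      = map_prod (cadjoint A\<^sub>2 \<circ> A\<^sub>2) (cadjoint A\<^sub>1 \<circ> A\<^sub>1)"
    by (auto simp: block_op_def fun_eq_iff)
  then show ?thesis
    by (simp add: op_abs_def op_powr_map_prod positive_op_cadjoint_compose A)
qed

lemma norm_off_diagonal_le:
  fixes X\<^sub>1 X\<^sub>2 :: "'a::complex_inner \<Rightarrow> 'a"
  assumes X: "bounded_clinear X\<^sub>1" "bounded_clinear X\<^sub>2"
  shows "norm (block_op (\<lambda>_. 0) X\<^sub>1 X\<^sub>2 (\<lambda>_. 0) v) \<le> max (onorm X\<^sub>1) (onorm X\<^sub>2) * norm v"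
proof -
  define K where "K = max (onorm X\<^sub>1) (onorm X\<^sub>2)"
  obtain x y where v: "v = (x, y)" by (cases v)
  have K: "K \<ge> 0"
    unfolding K_def using onorm_pos_le[OF bounded_clinear_imp_bounded_linear[OF X(1)]] by simp
  have le: "norm (X\<^sub>1 y) \<le> K * norm y" "norm (X\<^sub>2 x) \<le> K * norm x"
    unfolding K_def
    by (rule order_trans[OF onorm_bounded_clinear[OF X(1)]] order_trans[OF onorm_bounded_clinear[OF X(2)]],
        simp add: mult_right_mono)+
  have "(norm (X\<^sub>1 y))\<^sup>2 + (norm (X\<^sub>2 x))\<^sup>2 \<le> (K * norm y)\<^sup>2 + (K * norm x)\<^sup>2"
    by (intro add_mono power_mono le) auto
  also have "\<dots> = (K * norm v)\<^sup>2"
    by (simp add: v norm_Pair power_mult_distrib algebra_simps)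
  finally have "norm (X\<^sub>1 y, X\<^sub>2 x) \<le> K * norm v"
    unfolding norm_Pair using K by (intro real_le_lsqrt) auto
  then show ?thesis
    by (simp add: v block_op_def K_def)
qed

text \<open>The r-th root of C bounds every member of the set, including the inserted 0, which also
  makes the supremum nonnegative.\<close>

lemma numerical_radius_powr_le:
  fixes T :: "'a::complex_inner \<Rightarrow> 'a"
  assumes "r > 0" "C \<ge> 0" and le: "\<And>x. norm x = 1 \<Longrightarrow> cmod (cinner (T x) x) powr r \<le> C"
  shows "numerical_radius T powr r \<le> C"
proof -
  let ?S = "insert 0 {cmod (cinner (T x) x) | x. norm x = 1}"
  have bound: "y \<le> C powr (1 / r)" if "y \<in> ?S" for y
  proof -
    have "y \<ge> 0" "y powr r \<le> C"
      using that le assms by auto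
    then have "(y powr r) powr (1 / r) \<le> C powr (1 / r)"
      using assms by (intro powr_mono2) auto
    then show ?thesis
      using \<open>y \<ge> 0\<close> assms by (simp add: powr_powr)
  qed
  have "numerical_radius T \<le> C powr (1 / r)"
    unfolding numerical_radius_def by (rule cSup_least) (use bound in auto)
  moreover have "0 \<le> numerical_radius T"
    unfolding numerical_radius_def by (rule cSup_upper) (use bound in \<open>auto intro!: bdd_aboveI\<close>)
  ultimately have "numerical_radius T powr r \<le> (C powr (1 / r)) powr r"
    using assms by (intro powr_mono2) auto
  then show ?thesis
    using assms by (simp add: powr_powr)
qed

theorem theorem3p37:
  fixes A\<^sub>1 A\<^sub>2 B\<^sub>1 B\<^sub>2 X\<^sub>1 X\<^sub>2 :: "'a::chilbert_space \<Rightarrow> 'a"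
    and AA BB YY :: "'a \<times> 'a \<Rightarrow> 'a \<times> 'a"
    and r \<alpha> :: real
  assumes "bounded_clinear A\<^sub>1" and "bounded_clinear A\<^sub>2"
    and "bounded_clinear B\<^sub>1" and "bounded_clinear B\<^sub>2"
    and "bounded_clinear X\<^sub>1" and "bounded_clinear X\<^sub>2"
    and "AA = block_op (\<lambda>_. 0) A\<^sub>1 A\<^sub>2 (\<lambda>_. 0)"
    and "BB = block_op (\<lambda>_. 0) B\<^sub>1 B\<^sub>2 (\<lambda>_. 0)"
    and "YY = block_op (\<lambda>_. 0) X\<^sub>1 X\<^sub>2 (\<lambda>_. 0)"
    and "r \<ge> 2" and "\<alpha> \<in> {0..1}"
  shows "numerical_radius (op_powr (op_abs AA) \<alpha> \<circ> YY \<circ> op_powr (op_abs BB) (1 - \<alpha>)) powr r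
    \<le> max (onorm X\<^sub>1 powr r) (onorm X\<^sub>2 powr r) *
      max (onorm (\<lambda>x. \<alpha> *\<^sub>R op_powr (op_abs A\<^sub>2) r x + (1 - \<alpha>) *\<^sub>R op_powr (op_abs B\<^sub>2) r x))
          (onorm (\<lambda>x. \<alpha> *\<^sub>R op_powr (op_abs A\<^sub>1) r x + (1 - \<alpha>) *\<^sub>R op_powr (op_abs B\<^sub>1) r x))"
proof -
  let ?G\<^sub>1 = "\<lambda>x. \<alpha> *\<^sub>R op_powr (op_abs A\<^sub>1) r x + (1 - \<alpha>) *\<^sub>R op_powr (op_abs B\<^sub>1) r x"
  let ?G\<^sub>2 = "\<lambda>x. \<alpha> *\<^sub>R op_powr (op_abs A\<^sub>2) r x + (1 - \<alpha>) *\<^sub>R op_powr (op_abs B\<^sub>2) r x"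
  note pos = assms(1-4)[THEN positive_op_abs]
  have abs_AA: "op_abs AA = map_prod (op_abs A\<^sub>2) (op_abs A\<^sub>1)"
    and abs_BB: "op_abs BB = map_prod (op_abs B\<^sub>2) (op_abs B\<^sub>1)"
    using assms by (simp_all add: op_abs_off_diagonal)
  define K where "K = max (onorm X\<^sub>1) (onorm X\<^sub>2)"
  define G where "G = max (onorm ?G\<^sub>2) (onorm ?G\<^sub>1)"
  have r0: "r \<ge> 0" and \<alpha>: "0 \<le> \<alpha>" "\<alpha> \<le> 1"
    using assms(10,11) by auto
  have bl: "bounded_linear ?G\<^sub>1" "bounded_linear ?G\<^sub>2"
    using r0 by (intro bounded_linear_add bounded_linear_const_scaleR
        bounded_clinear_imp_bounded_linear bounded_clinear_op_powr pos; simp)+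
  have G0: "G \<ge> 0"
    unfolding G_def using onorm_pos_le[OF bl(1)] by simp
  have X0: "onorm X\<^sub>1 \<ge> 0" "onorm X\<^sub>2 \<ge> 0"
    using assms(5,6) by (simp_all add: onorm_pos_le bounded_clinear_imp_bounded_linear)
  have K_powr: "K powr r = max (onorm X\<^sub>1 powr r) (onorm X\<^sub>2 powr r)"
  proof (cases "onorm X\<^sub>1 \<le> onorm X\<^sub>2")
    case True
    then show ?thesis
      using X0 r0 powr_mono2[of r "onorm X\<^sub>1" "onorm X\<^sub>2"] by (simp add: K_def max_absorb2)
  next
    case False
    then show ?thesis
      using X0 r0 powr_mono2[of r "onorm X\<^sub>2" "onorm X\<^sub>1"] by (simp add: K_def max_absorb1)
  qed
  have "numerical_radius (op_powr (op_abs AA) \<alpha> \<circ> YY \<circ> op_powr (op_abs BB) (1 - \<alpha>)) powr r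
      \<le> K powr r * G"
  proof (rule numerical_radius_powr_le)
    fix v :: "'a \<times> 'a" assume v: "norm v = 1"
    obtain x y where xy: "v = (x, y)" by (cases v)
    have "cmod (cinner ((op_powr (op_abs AA) \<alpha> \<circ> YY \<circ> op_powr (op_abs BB) (1 - \<alpha>)) v) v) powr r
        \<le> K powr r * (\<alpha> * Re (cinner (op_powr (op_abs AA) r v) v)
          + (1 - \<alpha>) * Re (cinner (op_powr (op_abs BB) r v) v))"
      unfolding comp_def
    proof (rule numerical_range_weighted_bound)
      show "norm (YY w) \<le> K * norm w" for w
        unfolding assms(9) K_def by (rule norm_off_diagonal_le[OF assms(5,6)])
    qed (use pos \<alpha> v assms(10) in \<open>auto simp: abs_AA abs_BB positive_op_map_prod\<close>)
    \<comment> \<open>The four diagonal terms are regrouped by coordinate: index 2 acts on x, index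
      1 on y.\<close>
    also have "\<alpha> * Re (cinner (op_powr (op_abs AA) r v) v)
          + (1 - \<alpha>) * Re (cinner (op_powr (op_abs BB) r v) v)
        = Re (cinner (?G\<^sub>2 x) x) + Re (cinner (?G\<^sub>1 y) y)"
      by (simp add: xy abs_AA abs_BB op_powr_map_prod pos r0 cinner_prod_def cinner_add_left
          cinner_scaleR_left distrib_left add_ac)
    \<comment> \<open>Bounding both forms by the larger norm G gives the maximum and not the sum,
      since the squared norms of x and y add up to 1.\<close>
    also have "\<dots> \<le> G * (norm x)\<^sup>2 + G * (norm y)\<^sup>2"
    proof (rule add_mono)
      show "Re (cinner (?G\<^sub>2 x) x) \<le> G * (norm x)\<^sup>2"
        using order_trans[OF Re_cinner_le mult_right_mono[OF onorm[OF bl(2)]], of x x]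
        by (rule order_trans) (simp_all add: G_def power2_eq_square mult.assoc mult_right_mono)
      show "Re (cinner (?G\<^sub>1 y) y) \<le> G * (norm y)\<^sup>2"
        using order_trans[OF Re_cinner_le mult_right_mono[OF onorm[OF bl(1)]], of y y]
        by (rule order_trans) (simp_all add: G_def power2_eq_square mult.assoc mult_right_mono)
    qed
    also have "\<dots> = G"
    proof -
      have "(norm x)\<^sup>2 + (norm y)\<^sup>2 = 1"
        using v by (simp add: xy norm_Pair)
      then show ?thesis by (simp flip: distrib_left)
    qed
    finally show "cmod (cinner ((op_powr (op_abs AA) \<alpha> \<circ> YY \<circ> op_powr (op_abs BB) (1 - \<alpha>)) v) v) powr r
        \<le> K powr r * G"
      by (simp add: mult_left_mono)
  qed (use assms(10) G0 in auto)
  then show ?thesis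
    unfolding K_powr G_def .
qed

end
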